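(* Let $p\in[1,+\infty)$, $p\neq d_y/2$. Suppose: (i) there is a constant $a>p$ such that $\mathbb{E}[\exp(\|\varepsilon\|^a)]<+\infty$; (ii) for a.e. $x\in\mathcal{X}$, every $n$ and any $\alpha\in(0,1)$ there exists a constant $\kappa_{p,n}(\alpha,x)>0$ such that $$\mathbb{P}\{\|f^*(x)-\hat f_n(x)\|^p>\kappa_{p,n}^p(\alpha,x)\}\le\alpha,\qquad \mathbb{P}\Big\{\tfrac1n\sum_{i=1}^n\|f^*(x^i)-\hat f_n(x^i)\|^p>\kappa_{p,n}^p(\alpha,x)\Big\}\le\alpha;$$ (iii) $c(\cdot,y)$ is lower semicontinuous on $\mathcal Z$ for each $y\in\mathcal Y$, $c(z,\cdot)$ is continuous on $\mathcal Y$ for each $z\in\mathcal Z$, and there is a constant $B_{c,p}\ge0$ with $|c(z,y)|\le B_{c,p}(1+\|y\|^p)$ for all $z\in\mathcal Z$, $y\in\mathcal Y$; (iv) the sequence of risk levels $\{\alpha_n\}\subset(0,1)$ satisfies $\sum_n\alpha_n<\infty$ and $\lim_{n\to\infty}\zeta_n(\alpha_n,x)=0$ for a.e. $x\in\mathcal X$, with the radius $\zeta_n$ defined in the context; (v) the samples $\{\varepsilon^i\}_{i=1}^n$ are i.i.d. Then, for a.e. $x\in\mathcal X$, the optimal value $\hat v^{DRO}_n(x)$ and solution $\hat z^{DRO}_n(x)$ of the Wasserstein ER-DRO problem with ambiguity set $\hat{\mathcal P}_n(x;\zeta_n(\alpha_n,x))$ satisfy, as $n\to\infty$, $$\hat v^{DRO}_n(x)\xrightarrow{p}v^*(x),\qquad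 \mathrm{dist}(\hat z^{DRO}_n(x),S^*(x))\xrightarrow{p}0,\qquad g(\hat z^{DRO}_n(x);x)\xrightarrow{p}v^*(x).$$
   Context: Setup. $Y=f^*(X)+\varepsilon$, where $X$ is a random vector with support $\mathcal X\subseteq\mathbb R^{d_x}$ and distribution $P_X$, $Y$ has nonempty convex support $\mathcal Y\subseteq\mathbb R^{d_y}$, $f^*(x):=\mathbb E[Y\mid X=x]$, and the zero-mean error $\varepsilon$ (distribution $P_\varepsilon$) is independent of $X$. $P_{Y\mid X=x}$ is the conditional distribution of $Y$ given $X=x$, i.e. the law of $f^*(x)+\varepsilon$. "A.e. $x$" is with respect to $P_X$. $\|\cdot\|$ is the Euclidean norm and $\mathrm{dist}(v,B):=\inf_{w\in B}\|v-w\|$. $\mathcal Z\subseteq\mathbb R^{d_z}$ is nonempty and compact, $c:\mathcal Z\times\mathcal Y\to\mathbb R$, $\mathbb E|c(z,f^*(x)+\varepsilon)|<\infty$ for each $z\in\mathcal Z$ and a.e. $x$, and $g(z;x):=\mathbb E[c(z,f^*(x)+\varepsilon)]$ is lower semicontinuous in $z$ on $\mathcal Z$ for a.e. $x$. The true problem is $v^*(x):=\min_{z\in\mathcal Z}g(z;x)$ with set of optimal solutions $S^*(x)$. All functions, sets and selections are assumed measurable. Data. $\mathcal D_n=\{(y^i,x^i)\}_{i=1}^n$ are joint observations of $(Y,X)$, $\varepsilon^i:=y^i-f^*(x^i)$; $\hat f_n$ is an estimate of $f^*$ built from $\mathcal D_n$ by a regression method, with residuals $\hat\varepsilon^i_n:=y^i-\hat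 f_n(x^i)$. Probabilities $\mathbb P$ and convergence in probability refer to the data. With $\mathrm{proj}_{\mathcal Y}$ the orthogonal projection onto $\mathcal Y$ and $\delta$ the Dirac measure, $$P^*_n(x):=\tfrac1n\sum_{i=1}^n\delta_{f^*(x)+\varepsilon^i},\qquad \hat P^{ER}_n(x):=\tfrac1n\sum_{i=1}^n\delta_{\mathrm{proj}_{\mathcal Y}(\hat f_n(x)+\hat\varepsilon^i_n)} .$$ Wasserstein ER-DRO. $\mathcal P(\mathcal Y)$ is the set of probability distributions supported in $\mathcal Y$; $d_{W,p}(Q_1,Q_2):=\big(\inf_\pi\int\|y_1-y_2\|^p\,d\pi\big)^{1/p}$, infimum over couplings $\pi$ of $Q_1,Q_2$. For $\zeta\ge0$, $\hat{\mathcal P}_n(x;\zeta):=\{Q\in\mathcal P(\mathcal Y): d_{W,p}(Q,\hat P^{ER}_n(x))\le\zeta\}$. The ER-DRO problem is $\hat v^{DRO}_n(x)=\min_{z\in\mathcal Z}\sup_{Q\in\hat{\mathcal P}_n(x;\zeta)}\mathbb E_{Y\sim Q}[c(z,Y)]$, whose objective is assumed real-valued and lower semicontinuous on $\mathcal Z$ for each $x$; $\hat z^{DRO}_n(x)$ denotes an optimal solution. Radius. Let $C\ge1$, $c_0>0$ be the constants (depending only on $a$, $d_y$ and $\mathbb E[\exp(\|\varepsilon\|^a)]$) of the measure concentration inequality, quoted from the literature, $$\mathbb P\{d_{W,p}(P^*_n(x),P_{Y\mid X=x})\ge\kappa\}\le\begin{cases}C\exp(-c_0n\kappa^{\max\{d_y/p,2\}}),&\kappa\le1,\\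 C\exp(-c_0n\kappa^{a/p}),&\kappa>1,\end{cases}$$ for all $\kappa>0$, $n\in\mathbb N$, $x\in\mathcal X$. Setting the right-hand side equal to $\alpha/2$ gives $$\kappa^{(2)}_{p,n}(\alpha):=\begin{cases}\big(\tfrac{\log(2C/\alpha)}{c_0n}\big)^{\min\{p/d_y,1/2\}},&n\ge\log(2C/\alpha)/c_0,\\ \big(\tfrac{\log(2C/\alpha)}{c_0n}\big)^{p/a},&n<\log(2C/\alpha)/c_0.\end{cases}$$ The radius is $\zeta_n(\alpha,x):=2\kappa_{p,n}(\alpha/4,x)+\kappa^{(2)}_{p,n}(\alpha)$. *)

theory Defs
  imports "HOL-Probability.Probability"
begin

definition support_of :: "'a::topological_space measure \<Rightarrow> 'a set" where
  "support_of Q = {x. \<forall>U. open U \<longrightarrow> x \<in> U \<longrightarrow> emeasure Q U > 0}"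

definition lsc_on :: "'a::topological_space set \<Rightarrow> ('a \<Rightarrow> real) \<Rightarrow> bool" where
  "lsc_on S f \<longleftrightarrow> (\<forall>x\<in>S. \<forall>t. t < f x \<longrightarrow> (\<forall>\<^sub>F y in at x within S. t < f y))"

text \<open>
  Convergence in probability of random variables to a constant.  Measurability is part of the
  notion: the library assigns measure 0 to non-measurable sets, so without it the limit could
  hold for no reason.
\<close>
definition tendsto_in_prob :: "'w measure \<Rightarrow> (nat \<Rightarrow> 'w \<Rightarrow> real) \<Rightarrow> real \<Rightarrow> bool" where
  "tendsto_in_prob M V l \<longleftrightarrow>
     (\<forall>\<^sub>F n in sequentially. V n \<in> borel_measurable M) \<and>
     (\<forall>\<delta>>0. (\<lambda>n. measure M {\<omega> \<in> space M. \<bar>V n \<omega> - l\<bar> > \<delta>}) \<longlonglongrightarrow> 0)"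

definition couplings :: "'y::euclidean_space measure \<Rightarrow> 'y measure \<Rightarrow> ('y \<times> 'y) measure set" where
  "couplings Q1 Q2 = {\<pi>. prob_space \<pi> \<and> sets \<pi> = sets (borel \<Otimes>\<^sub>M borel) \<and>
     distr \<pi> borel fst = Q1 \<and> distr \<pi> borel snd = Q2}"

definition transport_cost :: "real \<Rightarrow> 'y::euclidean_space measure \<Rightarrow> 'y measure \<Rightarrow> ennreal" where
  "transport_cost p Q1 Q2 =
     (INF \<pi>\<in>couplings Q1 Q2. \<integral>\<^sup>+(y1, y2). ennreal (norm (y1 - y2) powr p) \<partial>\<pi>)"

text \<open>Extended-valued, because there is no power function with real exponents on
  \<^typ>\<open>ennreal\<close> and \<^const>\<open>enn2real\<close> sends infinity to 0.\<close>
definition wasserstein :: "real \<Rightarrow> 'y::euclidean_space measure \<Rightarrow> 'y measure \<Rightarrow> ennreal" where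
  "wasserstein p Q1 Q2 =
     (if transport_cost p Q1 Q2 = \<infinity> then \<infinity>
      else ennreal (enn2real (transport_cost p Q1 Q2) powr (1 / p)))"

definition prob_measures_on :: "'y::euclidean_space set \<Rightarrow> 'y measure set" where
  "prob_measures_on YY = {Q. prob_space Q \<and> sets Q = sets borel \<and> emeasure Q YY = 1}"

definition wasserstein_ball ::
  "real \<Rightarrow> 'y::euclidean_space set \<Rightarrow> 'y measure \<Rightarrow> real \<Rightarrow> 'y measure set" where
  "wasserstein_ball p YY P \<zeta> = {Q \<in> prob_measures_on YY. wasserstein p Q P \<le> ennreal \<zeta>}"

definition empirical :: "nat \<Rightarrow> (nat \<Rightarrow> 'y::euclidean_space) \<Rightarrow> 'y measure" where
  "empirical n h = distr (uniform_count_measure {1..n}) borel h"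

text \<open>This is the average of the Dirac measures at the points \<open>h 1, \<dots>, h n\<close>.\<close>
lemma measure_empirical:
  assumes "A \<in> sets borel"
  shows "measure (empirical n h) A = (\<Sum>i=1..n. measure (return borel (h i)) A) / real n"
proof -
  have "measure (empirical n h) A =
      measure (uniform_count_measure {1..n}) (h -` A \<inter> space (uniform_count_measure {1..n}))"
    unfolding empirical_def
    by (rule measure_distr) (use assms in \<open>auto simp: measurable_def sets_uniform_count_measure
      space_uniform_count_measure\<close>)
  also have "\<dots> = real (card (h -` A \<inter> {1..n})) / real n"
    by (simp add: space_uniform_count_measure measure_uniform_count_measure)
  also have "real (card (h -` A \<inter> {1..n})) = (\<Sum>i=1..n. real (indicator (h -` A) i))"
    unfolding of_nat_sum[symmetric] by (simp add: sum_indicator_eq_card Int_commute)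
  also have "\<dots> = (\<Sum>i=1..n. measure (return borel (h i)) A)"
    using assms by (intro sum.cong) (auto simp: measure_return indicator_def)
  finally show ?thesis .
qed

definition data_set ::
  "(nat \<Rightarrow> 'w \<Rightarrow> 'y) \<Rightarrow> (nat \<Rightarrow> 'w \<Rightarrow> 'x) \<Rightarrow> nat \<Rightarrow> 'w \<Rightarrow> (nat \<Rightarrow> 'y \<times> 'x)" where
  "data_set ys xs n \<omega> = (\<lambda>i\<in>{1..n}. (ys i \<omega>, xs i \<omega>))"

text \<open>The law of \<open>f x + \<epsilon>\<close> when \<open>\<epsilon>\<close> has law \<open>Pe\<close>: the conditional law of \<open>f X + \<epsilon>\<close>
  given \<open>X = x\<close> for \<open>\<epsilon>\<close> independent of \<open>X\<close>.\<close>
definition cond_law ::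
  "('x \<Rightarrow> 'y::euclidean_space) \<Rightarrow> 'y measure \<Rightarrow> 'x \<Rightarrow> 'y measure" where
  "cond_law f Pe x = distr Pe borel (\<lambda>e. f x + e)"

text \<open>In the next two definitions \<open>xi\<close> and \<open>yi\<close> are the realised observations.\<close>
definition full_info_empirical ::
  "('x \<Rightarrow> 'y::euclidean_space) \<Rightarrow> nat \<Rightarrow> (nat \<Rightarrow> 'y) \<Rightarrow> (nat \<Rightarrow> 'x) \<Rightarrow> 'x \<Rightarrow> 'y measure" where
  "full_info_empirical f n yi xi x = empirical n (\<lambda>i. f x + (yi i - f (xi i)))"

definition residual_empirical ::
  "'y set \<Rightarrow> ('x \<Rightarrow> 'y::euclidean_space) \<Rightarrow> nat \<Rightarrow> (nat \<Rightarrow> 'y) \<Rightarrow> (nat \<Rightarrow> 'x) \<Rightarrow> 'x \<Rightarrow> 'y measure" where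
  "residual_empirical YY fh n yi xi x =
     empirical n (\<lambda>i. closest_point YY (fh x + (yi i - fh (xi i))))"

definition true_objective ::
  "('z \<Rightarrow> 'y \<Rightarrow> real) \<Rightarrow> ('x \<Rightarrow> 'y::euclidean_space) \<Rightarrow> 'y measure \<Rightarrow> 'z \<Rightarrow> 'x \<Rightarrow> real" where
  "true_objective c f Pe z x = (\<integral>e. c z (f x + e) \<partial>Pe)"

definition worst_case :: "('z \<Rightarrow> 'y \<Rightarrow> real) \<Rightarrow> 'y measure set \<Rightarrow> 'z \<Rightarrow> real" where
  "worst_case c A z = (SUP Q\<in>A. \<integral>y. c z y \<partial>Q)"

definition min_value :: "'z set \<Rightarrow> ('z \<Rightarrow> real) \<Rightarrow> real" where
  "min_value Z h = (INF z\<in>Z. h z)"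

definition minimizers :: "'z set \<Rightarrow> ('z \<Rightarrow> real) \<Rightarrow> 'z set" where
  "minimizers Z h = {z. is_arg_min h (\<lambda>z. z \<in> Z) z}"

text \<open>The infimum is a minimum in the setting of interest.\<close>
lemma min_value_attained:
  fixes Z :: "'z::euclidean_space set"
  assumes "compact Z" "Z \<noteq> {}" "lsc_on Z h"
  shows "\<exists>z\<in>minimizers Z h. min_value Z h = h z"
proof -
  have "\<exists>z\<in>Z. \<forall>w\<in>Z. h z \<le> h w"
  proof (rule ccontr)
    assume "\<not> ?thesis"
    then have "\<forall>z\<in>Z. \<exists>w. w \<in> Z \<and> h w < h z" by (auto simp: not_le)
    from bchoice[OF this] obtain w where w: "\<And>z. z \<in> Z \<Longrightarrow> w z \<in> Z \<and> h (w z) < h z"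
      by blast
    have "\<forall>z\<in>Z. \<exists>U. open U \<and> z \<in> U \<and> (\<forall>y\<in>U \<inter> Z. h (w z) < h y)"
    proof
      fix z assume that: "z \<in> Z"
      have "\<forall>\<^sub>F y in at z within Z. h (w z) < h y"
        using assms(3) w that by (auto simp: lsc_on_def)
      then obtain U where "open U" "z \<in> U" "\<forall>y\<in>U. y \<noteq> z \<longrightarrow> y \<in> Z \<longrightarrow> h (w z) < h y"
        unfolding eventually_at_topological by blast
      with w[OF that] show "\<exists>U. open U \<and> z \<in> U \<and> (\<forall>y\<in>U \<inter> Z. h (w z) < h y)"
        by (intro exI[of _ U]) auto
    qed
    from bchoice[OF this] obtain U where U: "\<And>z. z \<in> Z \<Longrightarrow> open (U z) \<and> z \<in> U z \<and> (\<forall>y\<in>U z \<inter> Z. h (w z) < h y)"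
      by blast
    have "Z \<subseteq> (\<Union>z\<in>Z. U z)" using U by blast
    then obtain F where F: "F \<subseteq> Z" "finite F" "Z \<subseteq> (\<Union>z\<in>F. U z)"
      using compactE_image[OF assms(1), of Z U] U by (metis (no_types))
    have "F \<noteq> {}" using F(3) assms(2) by blast
    then obtain z where z: "z \<in> F" "\<And>y. y \<in> F \<Longrightarrow> h (w z) \<le> h (w y)"
      using ex_is_arg_min_if_finite[OF F(2), of "\<lambda>z. h (w z)"] by (auto simp: is_arg_min_def not_less)
    have wz: "w z \<in> Z" using w z(1) F(1) by blast
    then obtain y where y: "y \<in> F" "w z \<in> U y" using F(3) by blast
    then have "h (w y) < h (w z)" using U[of y] F(1) wz by blast
    with z(2)[OF y(1)] show False by simp
  qed
  then obtain z where z: "z \<in> Z" "\<And>w. w \<in> Z \<Longrightarrow> h z \<le> h w" by blast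
  then have "min_value Z h = h z"
    unfolding min_value_def by (intro cInf_eq_minimum) auto
  moreover have "z \<in> minimizers Z h"
    using z by (auto simp: minimizers_def is_arg_min_def not_less)
  ultimately show ?thesis by blast
qed

text \<open>\<open>kappa2\<close> solves \<open>concentration_bound C c0 a p d n k = \<alpha> / 2\<close> for \<open>k\<close>.\<close>
definition concentration_bound ::
  "real \<Rightarrow> real \<Rightarrow> real \<Rightarrow> real \<Rightarrow> nat \<Rightarrow> nat \<Rightarrow> real \<Rightarrow> real" where
  "concentration_bound C c0 a p d n k =
     (if k \<le> 1 then C * exp (- c0 * real n * k powr max (real d / p) 2)
      else C * exp (- c0 * real n * k powr (a / p)))"

definition kappa2 ::
  "real \<Rightarrow> real \<Rightarrow> real \<Rightarrow> real \<Rightarrow> nat \<Rightarrow> nat \<Rightarrow> real \<Rightarrow> real" where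
  "kappa2 C c0 a p d n \<alpha> =
     (if real n \<ge> ln (2 * C / \<alpha>) / c0
      then (ln (2 * C / \<alpha>) / (c0 * real n)) powr min (p / real d) (1 / 2)
      else (ln (2 * C / \<alpha>) / (c0 * real n)) powr (p / a))"

end

theory Submission
  imports Defs
begin

text \<open>
  Fix a good \<open>x\<close> and let \<open>P\<close> be the law of \<open>fstar x + \<epsilon>\<close>.  The projection onto the convex set
  \<open>YY\<close> is nonexpansive, so the two regression bounds put the residual empirical measure within
  \<open>2 * kappa\<close> of the full-information one, which is within \<open>kappa2\<close> of \<open>P\<close> by the concentration
  inequality.  Hence \<open>P\<close> lies in the ambiguity set except on an event of probability at most
  \<open>alpha n\<close>, and there \<open>vstar x \<le> g (zhat n x) x \<le> vhat n x\<close>.  Conversely every member of the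
  ambiguity set is within \<open>3 * zeta\<close> of \<open>P\<close>, and \<open>Q \<mapsto> \<integral> c z dQ\<close> is continuous at \<open>P\<close> for the
  Wasserstein distance; at a minimizer \<open>z\<close> of the true problem this gives
  \<open>vhat n x \<le> vstar x + \<delta>\<close> for large \<open>n\<close>.  Lower semicontinuity of \<open>g\<close> on the compact set \<open>Z\<close>
  turns near-optimality of \<open>zhat\<close> into closeness to the optimal set.
\<close>

section \<open>Convexity inequalities for powers\<close>

text \<open>Convexity of the power function covers positive \<open>u\<close> and \<open>v\<close>.
  If one of them vanishes, the claim reduces to \<open>r powr p \<le> r\<close> on the unit
  interval.\<close>

lemma powr_convex_combination:
  fixes p s t u v :: real
  assumes p: "p \<ge> 1" and st: "s \<ge> 0" "t \<ge> 0" "s + t = 1" and uv: "u \<ge> 0" "v \<ge> 0"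
  shows "(s * u + t * v) powr p \<le> s * u powr p + t * v powr p"
proof -
  have le_self: "r powr p \<le> r" if "0 \<le> r" "r \<le> 1" for r :: real
    using powr_mono'[OF p that] that by simp
  show ?thesis
  proof (cases "u = 0 \<or> v = 0")
    case True
    then show ?thesis
      using le_self[of s] le_self[of t] st uv p
      by (auto simp: powr_mult intro!: mult_right_mono)
  next
    case False
    then show ?thesis
      using convex_onD[OF powr_convex[OF p], of t u v] st uv
      by (simp add: eq_diff_eq[THEN iffD2, OF st(3)])
  qed
qed

text \<open>Write \<open>u + v\<close> as \<open>A + B\<close> times the convex combination of
  \<open>u / A\<close> and \<open>v / B\<close> with weights \<open>A / (A + B)\<close> and
  \<open>B / (A + B)\<close>. When the integrals of \<open>u powr p\<close> and
  \<open>v powr p\<close> are at most \<open>A powr p\<close> and \<open>B powr p\<close>, the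
  right-hand side integrates to at most \<open>(A + B) powr p\<close>, which is the triangle
  inequality in the p-norm.\<close>

lemma powr_add_weighted_le:
  fixes p A B u v :: real
  assumes p: "p \<ge> 1" and AB: "A > 0" "B > 0" and uv: "u \<ge> 0" "v \<ge> 0"
  shows "(u + v) powr p
    \<le> (A + B) powr p * (A / (A + B) * (u powr p / A powr p) + B / (A + B) * (v powr p / B powr p))"
proof -
  have eq: "u + v = (A + B) * (A / (A + B) * (u / A) + B / (A + B) * (v / B))"
  proof -
    have "(A + B) * (A / (A + B) * (u / A) + B / (A + B) * (v / B))
        = (A + B) / (A + B) * (A / A * u + B / B * v)"
      by (simp only: distrib_left times_divide_eq_left times_divide_eq_right ac_simps)
    then show ?thesis using AB by simp
  qed
  have "(u + v) powr p = (A + B) powr p * (A / (A + B) * (u / A) + B / (A + B) * (v / B)) powr p"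
    by (subst eq, rule powr_mult)
  also have "\<dots> \<le> (A + B) powr p * (A / (A + B) * (u / A) powr p + B / (A + B) * (v / B) powr p)"
    using assms add_divide_distrib[of A B "A + B", symmetric]
    by (intro mult_left_mono powr_convex_combination) auto
  finally show ?thesis using AB uv by (simp add: powr_divide)
qed

lemma powr_add_le:
  fixes p u v :: real
  assumes "p \<ge> 1" "u \<ge> 0" "v \<ge> 0"
  shows "(u + v) powr p \<le> 2 powr p * (u powr p + v powr p)"
proof -
  have "(u + v) powr p \<le> 2 powr p * (1/2 * u powr p + 1/2 * v powr p)"
    using powr_add_weighted_le[of p 1 1 u v] assms by simp
  also have "\<dots> \<le> 2 powr p * (u powr p + v powr p)"
    by (intro mult_left_mono add_mono) auto
  finally show ?thesis .
qed

section \<open>Couplings: reversal and gluing\<close>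

abbreviation coupling_cost :: "real \<Rightarrow> ('y::euclidean_space \<times> 'y) measure \<Rightarrow> ennreal" where
  "coupling_cost p \<pi> \<equiv> (\<integral>\<^sup>+(y1, y2). ennreal (norm (y1 - y2) powr p) \<partial>\<pi>)"

lemma couplingsD:
  assumes "\<pi> \<in> couplings Q1 Q2"
  shows "prob_space \<pi>" "sets \<pi> = sets (borel \<Otimes>\<^sub>M borel)" "sets \<pi> = sets borel" "space \<pi> = UNIV"
    "distr \<pi> borel fst = Q1" "distr \<pi> borel snd = Q2"
    "fst \<in> measurable \<pi> borel" "snd \<in> measurable \<pi> borel"
proof -
  show s: "sets \<pi> = sets (borel \<Otimes>\<^sub>M borel)" and "prob_space \<pi>"
    and "distr \<pi> borel fst = Q1" "distr \<pi> borel snd = Q2"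
    using assms unfolding couplings_def by blast+
  show s': "sets \<pi> = sets borel" using s unfolding borel_prod .
  show "space \<pi> = UNIV" using sets_eq_imp_space_eq[OF s'] by simp
  show "fst \<in> measurable \<pi> borel" "snd \<in> measurable \<pi> borel"
    unfolding measurable_cong_sets[OF s refl] by simp_all
qed

lemma couplings_swap:
  fixes Q1 Q2 :: "'y::euclidean_space measure"
  assumes "\<pi> \<in> couplings Q1 Q2"
  shows "distr \<pi> (borel \<Otimes>\<^sub>M borel) (\<lambda>(a, b). (b, a)) \<in> couplings Q2 Q1"
    and "coupling_cost p (distr \<pi> (borel \<Otimes>\<^sub>M borel) (\<lambda>(a, b). (b, a))) = coupling_cost p \<pi>"
proof -
  note c = couplingsD[OF assms]
  have [measurable_cong]: "sets \<pi> = sets (borel \<Otimes>\<^sub>M borel)" by (rule c)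
  have m: "(\<lambda>(a, b). (b, a)) \<in> measurable \<pi> (borel \<Otimes>\<^sub>M borel)" by measurable
  show "distr \<pi> (borel \<Otimes>\<^sub>M borel) (\<lambda>(a, b). (b, a)) \<in> couplings Q2 Q1"
    unfolding couplings_def
  proof (intro CollectI conjI)
    show "distr (distr \<pi> (borel \<Otimes>\<^sub>M borel) (\<lambda>(a, b). (b, a))) borel fst = Q2"
      by (subst distr_distr[OF _ m]) (simp_all add: comp_def case_prod_unfold c(6))
    show "distr (distr \<pi> (borel \<Otimes>\<^sub>M borel) (\<lambda>(a, b). (b, a))) borel snd = Q1"
      by (subst distr_distr[OF _ m]) (simp_all add: comp_def case_prod_unfold c(5))
  qed (simp_all add: prob_space.prob_space_distr[OF c(1) m])
  show "coupling_cost p (distr \<pi> (borel \<Otimes>\<^sub>M borel) (\<lambda>(a, b). (b, a))) = coupling_cost p \<pi>"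
    by (subst nn_integral_distr[OF m]) (simp_all add: case_prod_unfold norm_minus_commute)
qed

text \<open>
  Gluing along \<open>Q2\<close> needs no disintegration when \<open>Q2\<close> is purely atomic (as empirical measures
  are): the glued measure has the density \<open>1 / Q2 {b}\<close> on the diagonal \<open>b = b'\<close> of
  \<open>\<pi>(da, db) \<Otimes> \<rho>(db', dc)\<close>.  The weighted convexity inequality then plays the role of Minkowski's.
\<close>
lemma couplings_glue:
  fixes Q1 Q2 Q3 :: "'y::euclidean_space measure"
  assumes p: "p \<ge> 1" and AB: "A > 0" "B > 0"
    and \<pi>: "\<pi> \<in> couplings Q1 Q2" and \<rho>: "\<rho> \<in> couplings Q2 Q3"
    and atoms: "AE y in Q2. emeasure Q2 {y} \<noteq> 0"
    and cost: "coupling_cost p \<pi> \<le> ennreal (A powr p)" "coupling_cost p \<rho> \<le> ennreal (B powr p)"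
  shows "\<exists>\<sigma>\<in>couplings Q1 Q3. coupling_cost p \<sigma> \<le> ennreal ((A + B) powr p)"
proof -
  note c = couplingsD[OF \<pi>] and d = couplingsD[OF \<rho>]
  interpret P: prob_space \<pi> by (rule c)
  interpret R: prob_space \<rho> by (rule d)
  interpret PR: pair_prob_space \<pi> \<rho> ..
  have sQ: "sets Q2 = sets borel" using c(6) by auto
  have [measurable_cong]: "sets \<pi> = sets (borel \<Otimes>\<^sub>M borel)" by (rule c)
  have [measurable_cong]: "sets \<rho> = sets (borel \<Otimes>\<^sub>M borel)" by (rule d)
  interpret Q: prob_space Q2
    unfolding c(6)[symmetric] by (rule P.prob_space_distr[OF c(8)])
  define e where "e b = emeasure Q2 {b}" for b
  \<comment> \<open>The singleton \<open>{b}\<close> is the section at \<open>b\<close> of the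
    closed diagonal, so the atom mass depends measurably on \<open>b\<close>.\<close>
  have "(\<lambda>b. emeasure Q2 (Pair b -` {w. fst w = snd w})) \<in> borel_measurable borel"
  proof (rule Q.measurable_emeasure_Pair)
    have "{w \<in> space (borel \<Otimes>\<^sub>M borel). fst w = (snd w::'y)} \<in> sets (borel \<Otimes>\<^sub>M borel)"
      by measurable
    then show "{w. fst w = snd w} \<in> sets (borel \<Otimes>\<^sub>M Q2)"
      using sQ by (simp add: space_pair_measure cong: sets_pair_measure_cong)
  qed
  then have em[measurable]: "e \<in> borel_measurable borel"
    unfolding e_def by (simp add: vimage_def)
  have e_inv: "e b * inverse (e b) = 1" if "e b \<noteq> 0" for b
    using that by (simp add: e_def divide_ennreal_def[symmetric] ennreal_divide_self Q.emeasure_eq_measure)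
  \<comment> \<open>Where \<open>e\<close> vanishes the value of \<open>inverse\<close> is infinite;
    by \<open>AE1\<close> and \<open>AE2\<close> such points are negligible.\<close>
  define D where "D w = (if snd (fst w) = fst (snd w) then inverse (e (snd (fst w))) else 0)"
    for w :: "('y \<times> 'y) \<times> ('y \<times> 'y)"
  have Dm[measurable]: "D \<in> borel_measurable (\<pi> \<Otimes>\<^sub>M \<rho>)"
    unfolding D_def by measurable
  define \<tau> where "\<tau> = density (\<pi> \<Otimes>\<^sub>M \<rho>) D"
  have [measurable_cong]: "sets \<tau> = sets (\<pi> \<Otimes>\<^sub>M \<rho>)" by (simp add: \<tau>_def)
  have fiber_sets: "{w. fst w = b} \<in> sets borel" "{w. snd w = b} \<in> sets borel" for b :: 'y
    by (auto intro!: borel_closed closed_Collect_eq continuous_intros)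
  have em_fiber: "emeasure \<rho> {w. fst w = b} = e b" "emeasure \<pi> {w. snd w = b} = e b" for b
    unfolding e_def
    by (subst d(5)[symmetric] c(6)[symmetric], subst emeasure_distr; simp add: c d vimage_def)+
  have AE1: "AE w in \<pi>. e (snd w) \<noteq> 0" and AE2: "AE w in \<rho>. e (fst w) \<noteq> 0"
    using atoms unfolding c(6)[symmetric] e_def[symmetric]
      apply (subst (asm) AE_distr_iff; simp add: c em e_def[symmetric])
    using atoms unfolding d(5)[symmetric] e_def[symmetric]
    apply (subst (asm) AE_distr_iff; simp add: d em e_def[symmetric])
    done
  \<comment> \<open>For fixed \<open>x = (a, b)\<close> the density is \<open>1 / e b\<close> on the
    fibre \<open>fst y = b\<close>, which has \<rho>-mass \<open>e b\<close>; hence it integrates to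
    1 in the other variable. The second marginal is symmetric.\<close>
  have fst_\<tau>: "distr \<tau> \<pi> fst = \<pi>"
  proof (rule measure_eqI)
    fix S assume "S \<in> sets (distr \<tau> \<pi> fst)"
    then have S[measurable]: "S \<in> sets \<pi>" by simp
    have "emeasure (distr \<tau> \<pi> fst) S = emeasure \<tau> (fst -` S \<inter> space \<tau>)"
      by (rule emeasure_distr) measurable
    also have "\<dots> = (\<integral>\<^sup>+w. D w * indicator (fst -` S \<inter> space \<tau>) w \<partial>(\<pi> \<Otimes>\<^sub>M \<rho>))"
      unfolding \<tau>_def by (subst emeasure_density) (auto simp: S)
    also have "\<dots> = (\<integral>\<^sup>+w. D w * indicator S (fst w) \<partial>(\<pi> \<Otimes>\<^sub>M \<rho>))"
      by (intro nn_integral_cong) (auto simp: indicator_def \<tau>_def)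
    also have "\<dots> = (\<integral>\<^sup>+x. (\<integral>\<^sup>+y. D (x, y) * indicator S x \<partial>\<rho>) \<partial>\<pi>)"
      by (subst R.nn_integral_fst[symmetric]) auto
    also have "\<dots> = (\<integral>\<^sup>+x. indicator S x \<partial>\<pi>)"
    proof (rule nn_integral_cong_AE, use AE1 in eventually_elim)
      fix x :: "'y \<times> 'y" assume x: "e (snd x) \<noteq> 0"
      have "(\<integral>\<^sup>+y. D (x, y) * indicator S x \<partial>\<rho>)
          = (\<integral>\<^sup>+y. (inverse (e (snd x)) * indicator S x) * indicator {w. fst w = snd x} y \<partial>\<rho>)"
        by (intro nn_integral_cong) (auto simp: D_def indicator_def)
      also have "\<dots> = indicator S x * (e (snd x) * inverse (e (snd x)))"
        by (subst nn_integral_cmult_indicator) (simp_all add: em_fiber fiber_sets d(3) ac_simps)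
      finally show "(\<integral>\<^sup>+y. D (x, y) * indicator S x \<partial>\<rho>) = indicator S x"
        by (simp only: e_inv[OF x] mult_1_right)
    qed
    finally show "emeasure (distr \<tau> \<pi> fst) S = emeasure \<pi> S" by simp
  qed simp
  have snd_\<tau>: "distr \<tau> \<rho> snd = \<rho>"
  proof (rule measure_eqI)
    fix S assume "S \<in> sets (distr \<tau> \<rho> snd)"
    then have S[measurable]: "S \<in> sets \<rho>" by simp
    have "emeasure (distr \<tau> \<rho> snd) S = emeasure \<tau> (snd -` S \<inter> space \<tau>)"
      by (rule emeasure_distr) measurable
    also have "\<dots> = (\<integral>\<^sup>+w. D w * indicator (snd -` S \<inter> space \<tau>) w \<partial>(\<pi> \<Otimes>\<^sub>M \<rho>))"
      unfolding \<tau>_def by (subst emeasure_density) (auto simp: S)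
    also have "\<dots> = (\<integral>\<^sup>+w. D w * indicator S (snd w) \<partial>(\<pi> \<Otimes>\<^sub>M \<rho>))"
      by (intro nn_integral_cong) (auto simp: indicator_def \<tau>_def)
    also have "\<dots> = (\<integral>\<^sup>+y. (\<integral>\<^sup>+x. D (x, y) * indicator S y \<partial>\<pi>) \<partial>\<rho>)"
      by (subst PR.nn_integral_snd[symmetric]) auto
    also have "\<dots> = (\<integral>\<^sup>+y. indicator S y \<partial>\<rho>)"
    proof (rule nn_integral_cong_AE, use AE2 in eventually_elim)
      fix y :: "'y \<times> 'y" assume y: "e (fst y) \<noteq> 0"
      have "(\<integral>\<^sup>+x. D (x, y) * indicator S y \<partial>\<pi>)
          = (\<integral>\<^sup>+x. (inverse (e (fst y)) * indicator S y) * indicator {w. snd w = fst y} x \<partial>\<pi>)"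
        by (intro nn_integral_cong) (auto simp: D_def indicator_def)
      also have "\<dots> = indicator S y * (e (fst y) * inverse (e (fst y)))"
        by (subst nn_integral_cmult_indicator) (simp_all add: em_fiber fiber_sets c(3) ac_simps)
      finally show "(\<integral>\<^sup>+x. D (x, y) * indicator S y \<partial>\<pi>) = indicator S y"
        by (simp only: e_inv[OF y] mult_1_right)
    qed
    finally show "emeasure (distr \<tau> \<rho> snd) S = emeasure \<rho> S" by simp
  qed simp
  have prob_\<tau>: "prob_space \<tau>"
  proof
    have "emeasure \<tau> (space \<tau>) = emeasure (distr \<tau> \<pi> fst) (space \<pi>)"
      by (subst emeasure_distr) (auto simp: \<tau>_def space_pair_measure intro!: arg_cong2[where f=emeasure])
    then show "emeasure \<tau> (space \<tau>) = 1"
      unfolding fst_\<tau> by (simp add: P.emeasure_space_1)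
  qed
  interpret T: prob_space \<tau> by (rule prob_\<tau>)
  have AE\<tau>: "AE w in \<tau>. snd (fst w) = fst (snd w)"
    unfolding \<tau>_def by (subst AE_density) (auto simp: D_def)
  define h where "h w = (fst (fst w), snd (snd w))" for w :: "('y \<times> 'y) \<times> ('y \<times> 'y)"
  have hm[measurable]: "h \<in> measurable \<tau> (borel \<Otimes>\<^sub>M borel)" unfolding h_def by measurable
  define \<sigma> where "\<sigma> = distr \<tau> (borel \<Otimes>\<^sub>M borel) h"
  have 1: "distr \<sigma> borel fst = Q1"
  proof -
    have "distr \<sigma> borel fst = distr (distr \<tau> \<pi> fst) borel fst"
      unfolding \<sigma>_def by (simp add: distr_distr comp_def h_def)
    then show ?thesis by (simp add: fst_\<tau> c)
  qed
  have 2: "distr \<sigma> borel snd = Q3"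
  proof -
    have "distr \<sigma> borel snd = distr (distr \<tau> \<rho> snd) borel snd"
      unfolding \<sigma>_def by (simp add: distr_distr comp_def h_def)
    then show ?thesis by (simp add: snd_\<tau> d)
  qed
  have \<sigma>: "\<sigma> \<in> couplings Q1 Q3"
    unfolding couplings_def using 1 2 T.prob_space_distr[OF hm] by (auto simp: \<sigma>_def)
  have cp: "coupling_cost p \<pi> = (\<integral>\<^sup>+w. ennreal (norm (fst (fst w) - snd (fst w)) powr p) \<partial>\<tau>)"
    by (subst fst_\<tau>[symmetric], subst nn_integral_distr) (auto simp: case_prod_unfold)
  have cr: "coupling_cost p \<rho> = (\<integral>\<^sup>+w. ennreal (norm (fst (snd w) - snd (snd w)) powr p) \<partial>\<tau>)"
    by (subst snd_\<tau>[symmetric], subst nn_integral_distr) (auto simp: case_prod_unfold)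
  \<comment> \<open>These are the coefficients of \<open>powr_add_weighted_le\<close>, balanced so
    that \<open>a * A powr p + b * B powr p\<close> is exactly
    \<open>(A + B) powr p\<close>.\<close>
  define a where "a = (A + B) powr p * (A / (A + B) / A powr p)"
  define b where "b = (A + B) powr p * (B / (A + B) / B powr p)"
  have ab: "a \<ge> 0" "b \<ge> 0" using AB by (auto simp: a_def b_def)
  have "coupling_cost p \<sigma> = (\<integral>\<^sup>+w. ennreal (norm (fst (fst w) - snd (snd w)) powr p) \<partial>\<tau>)"
    unfolding \<sigma>_def by (subst nn_integral_distr) (auto simp: case_prod_unfold h_def)
  also have "\<dots> \<le> (\<integral>\<^sup>+w. ennreal a * ennreal (norm (fst (fst w) - snd (fst w)) powr p)
      + ennreal b * ennreal (norm (fst (snd w) - snd (snd w)) powr p) \<partial>\<tau>)"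
  proof (rule nn_integral_mono_AE, use AE\<tau> in eventually_elim)
    fix w :: "('y \<times> 'y) \<times> ('y \<times> 'y)"
    assume w: "snd (fst w) = fst (snd w)"
    let ?u = "norm (fst (fst w) - snd (fst w))" and ?v = "norm (fst (snd w) - snd (snd w))"
    have "norm (fst (fst w) - snd (snd w)) \<le> ?u + ?v"
      using norm_triangle_ineq[of "fst (fst w) - snd (fst w)" "fst (snd w) - snd (snd w)"] w
      by simp
    then have "norm (fst (fst w) - snd (snd w)) powr p \<le> (?u + ?v) powr p"
      using p by (intro powr_mono2) auto
    also have "\<dots> \<le> a * ?u powr p + b * ?v powr p"
      using powr_add_weighted_le[OF p AB, of ?u ?v]
      by (simp add: a_def b_def algebra_simps)
    finally show "ennreal (norm (fst (fst w) - snd (snd w)) powr p)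
        \<le> ennreal a * ennreal (?u powr p) + ennreal b * ennreal (?v powr p)"
      using ab by (simp add: ennreal_mult[symmetric] ennreal_plus[symmetric] del: ennreal_plus)
  qed
  also have "\<dots> = ennreal a * coupling_cost p \<pi> + ennreal b * coupling_cost p \<rho>"
    unfolding cp cr by (simp add: nn_integral_add nn_integral_cmult)
  also have "\<dots> \<le> ennreal a * ennreal (A powr p) + ennreal b * ennreal (B powr p)"
    by (intro add_mono mult_left_mono cost) auto
  also have "\<dots> = ennreal (a * A powr p + b * B powr p)"
    using ab by (simp add: ennreal_mult)
  also have "a * A powr p + b * B powr p = (A + B) powr p"
  proof -
    have "a * A powr p + b * B powr p = (A + B) powr p * (A / (A + B) + B / (A + B))"
      using AB by (simp add: a_def b_def distrib_left)
    also have "A / (A + B) + B / (A + B) = 1"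
      using AB by (simp add: add_divide_distrib[symmetric])
    finally show ?thesis by simp
  qed
  finally show ?thesis using \<sigma> by blast
qed

section \<open>The support of a Borel measure\<close>

text \<open>By second countability the complement of the support is a union of countably many null
  basic open sets.\<close>

lemma AE_support_of:
  fixes Q :: "'a::second_countable_topology measure"
  assumes "sets Q = sets borel"
  shows "AE x in Q. x \<in> support_of Q"
proof -
  obtain \<B> :: "'a set set" where \<B>: "countable \<B>" "\<And>U. U \<in> \<B> \<Longrightarrow> open U"
    "\<And>S. open S \<Longrightarrow> \<exists>\<U>\<subseteq>\<B>. S = \<Union>\<U>"
    by (metis univ_second_countable)
  define \<N> where "\<N> = {U \<in> \<B>. emeasure Q U = 0}"
  have "AE x in Q. \<forall>U\<in>\<N>. x \<notin> U"
    using \<B>(1,2) assms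
    by (intro AE_ball_countable') (auto simp: \<N>_def intro!: AE_not_in null_setsI)
  then show ?thesis
  proof eventually_elim
    case (elim x)
    have "emeasure Q U > 0" if U: "open U" "x \<in> U" for U
    proof -
      obtain V where V: "V \<in> \<B>" "x \<in> V" "V \<subseteq> U"
        using \<B>(3)[OF U(1)] U(2) by blast
      then have "emeasure Q V \<noteq> 0" using elim by (auto simp: \<N>_def)
      moreover have "emeasure Q V \<le> emeasure Q U"
        using V U assms by (intro emeasure_mono) auto
      ultimately show ?thesis by (metis le_zero_eq not_gr_zero)
    qed
    then show ?case by (auto simp: support_of_def)
  qed
qed

lemma closed_support_of: "closed (support_of Q)"
  unfolding closed_def
proof (subst open_subopen, safe)
  fix x assume "x \<notin> support_of Q"
  then obtain U where "open U" "x \<in> U" "emeasure Q U = 0"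
    by (auto simp: support_of_def not_gr_zero)
  then show "\<exists>T. open T \<and> x \<in> T \<and> T \<subseteq> - support_of Q"
    by (intro exI[of _ U]) (auto simp: support_of_def)
qed

section \<open>Empirical measures\<close>

lemma empirical_simps [simp]:
  "sets (empirical n h) = sets borel" "space (empirical n h) = UNIV"
  by (simp_all add: empirical_def)

lemma measurable_uniform_count_measure [simp]:
  "f \<in> measurable (uniform_count_measure A) M \<longleftrightarrow> f \<in> A \<rightarrow> space M"
  by (auto simp: measurable_def space_uniform_count_measure sets_uniform_count_measure)

lemma emeasure_empirical_atom:
  assumes "i \<in> {1..n}"
  shows "emeasure (empirical n h) {h i} \<noteq> 0"
proof -
  have "emeasure (uniform_count_measure {1..n}) {i}
      \<le> emeasure (uniform_count_measure {1..n}) (h -` {h i} \<inter> space (uniform_count_measure {1..n}))"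
    using assms
    by (intro emeasure_mono) (auto simp: space_uniform_count_measure sets_uniform_count_measure)
  also have "\<dots> = emeasure (empirical n h) {h i}"
    unfolding empirical_def by (subst emeasure_distr) auto
  finally show ?thesis
    using assms by (auto simp: emeasure_uniform_count_measure)
qed

text \<open>Supplies the atomicity hypothesis of \<open>couplings_glue\<close>: only the finitely
  many sample points are charged, and each of them carries mass.\<close>

lemma AE_empirical_atom: "AE y in empirical n h. emeasure (empirical n h) {y} \<noteq> 0"
proof -
  have "AE y in empirical n h. y \<in> h ` {1..n}"
    unfolding empirical_def
    by (subst AE_distr_iff)
      (auto simp: space_uniform_count_measure intro!: AE_I2 borel_closed finite_imp_closed)
  then show ?thesis
    by eventually_elim (use emeasure_empirical_atom in blast)
qed

text \<open>Matching the two samples index by index gives a coupling, in general not an optimal one,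
  whose cost is explicit.\<close>

lemma empirical_coupling:
  fixes h h' :: "nat \<Rightarrow> 'y::euclidean_space"
  assumes n: "n \<ge> 1"
  shows "\<exists>\<pi>\<in>couplings (empirical n h) (empirical n h').
    coupling_cost p \<pi> = ennreal ((\<Sum>i=1..n. norm (h i - h' i) powr p) / real n)"
proof
  let ?U = "uniform_count_measure {1..n}" and ?k = "\<lambda>i. (h i, h' i)"
  let ?\<pi> = "distr ?U (borel \<Otimes>\<^sub>M borel) ?k"
  have m: "?k \<in> measurable ?U (borel \<Otimes>\<^sub>M borel)"
    by (auto simp: space_pair_measure)
  have U: "prob_space ?U" using n by (intro prob_space_uniform_count_measure) auto
  show "?\<pi> \<in> couplings (empirical n h) (empirical n h')"
    unfolding couplings_def
  proof (intro CollectI conjI)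
    show "distr ?\<pi> borel fst = empirical n h" "distr ?\<pi> borel snd = empirical n h'"
      unfolding empirical_def by (subst distr_distr[OF _ m], simp, simp add: comp_def)+
    show "prob_space ?\<pi>" by (rule prob_space.prob_space_distr[OF U m])
  qed simp
  have "coupling_cost p ?\<pi> = (\<integral>\<^sup>+i. ennreal (norm (h i - h' i) powr p) \<partial>?U)"
    by (subst nn_integral_distr[OF m]) (simp_all add: case_prod_unfold)
  also have "\<dots> = (\<Sum>i=1..n. ennreal (1 / real n) * ennreal (norm (h i - h' i) powr p))"
    unfolding uniform_count_measure_def by (subst nn_integral_point_measure_finite) auto
  also have "\<dots> = (\<Sum>i=1..n. ennreal (norm (h i - h' i) powr p / real n))"
    by (simp add: ennreal_mult[symmetric])
  finally show "coupling_cost p ?\<pi> = ennreal ((\<Sum>i=1..n. norm (h i - h' i) powr p) / real n)"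
    by (simp add: sum_divide_distrib)
qed

section \<open>Passing between Wasserstein bounds and couplings\<close>

lemma wasserstein_leI:
  assumes "p \<ge> 1" "r \<ge> 0" "\<pi> \<in> couplings Q1 Q2" "coupling_cost p \<pi> \<le> ennreal (r powr p)"
  shows "wasserstein p Q1 Q2 \<le> ennreal r"
proof -
  have le: "transport_cost p Q1 Q2 \<le> ennreal (r powr p)"
    unfolding transport_cost_def by (rule INF_lower2) (rule assms)+
  then have "enn2real (transport_cost p Q1 Q2) \<le> r powr p"
    by (intro enn2real_leI) auto
  then have "enn2real (transport_cost p Q1 Q2) powr (1 / p) \<le> (r powr p) powr (1 / p)"
    using assms by (intro powr_mono2) auto
  then have "enn2real (transport_cost p Q1 Q2) powr (1 / p) \<le> r"
    using assms by (simp add: powr_powr)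
  moreover have "transport_cost p Q1 Q2 \<noteq> \<infinity>"
    using le by (auto simp: top_unique)
  ultimately show ?thesis
    by (simp add: wasserstein_def ennreal_leI)
qed

text \<open>A strict bound on an infimum is beaten by some member, whether or not the infimum is
  attained.\<close>

lemma wasserstein_lessD:
  assumes "p \<ge> 1" "wasserstein p Q1 Q2 < ennreal r"
  shows "\<exists>\<pi>\<in>couplings Q1 Q2. coupling_cost p \<pi> \<le> ennreal (r powr p)"
proof -
  let ?T = "transport_cost p Q1 Q2"
  have fin: "?T \<noteq> \<infinity>" and less: "ennreal (enn2real ?T powr (1 / p)) < ennreal r"
    using assms(2) by (auto simp: wasserstein_def split: if_splits)
  then have less': "enn2real ?T powr (1 / p) < r"
    using ennreal_leI[of r "enn2real ?T powr (1 / p)"] by (auto simp: not_le[symmetric])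
  then have "(enn2real ?T powr (1 / p)) powr p < r powr p"
    using assms(1) by (intro powr_less_mono2) auto
  then have "ennreal (enn2real ?T) < ennreal (r powr p)"
    using assms(1) by (simp add: powr_powr ennreal_less_iff)
  then have "?T < ennreal (r powr p)"
    using fin by (simp add: less_top)
  then show ?thesis
    unfolding transport_cost_def INF_less_iff by (blast intro: less_imp_le)
qed

section \<open>Continuity of expectations under transport\<close>

text \<open>Dominated convergence along integer radii. It controls the growth term outside a large
  ball.\<close>

lemma integrable_tail_small:
  fixes f :: "'y::real_normed_vector \<Rightarrow> real"
  assumes P: "sets P = sets borel" and f: "integrable P f" and \<delta>: "\<delta> > 0"
  shows "\<exists>R\<ge>0. (\<integral>y. f y * indicator {y. norm y > R} y \<partial>P) \<le> \<delta>"
proof -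
  note [measurable_cong] = P
  have [measurable]: "f \<in> borel_measurable P" using f by auto
  have "(\<lambda>k. \<integral>y. f y * indicator {y. norm y > real k} y \<partial>P) \<longlonglongrightarrow> (\<integral>y. 0 \<partial>P)"
  proof (rule integral_dominated_convergence[where w="\<lambda>y. norm (f y)"])
    show "AE y in P. (\<lambda>k. f y * indicator {y. norm y > real k} y) \<longlonglongrightarrow> 0"
    proof (rule AE_I2)
      fix y :: 'y
      obtain k0 :: nat where k0: "norm y \<le> real k0" using real_arch_simple by blast
      have "\<forall>\<^sub>F k in sequentially. f y * indicator {y. norm y > real k} y = 0"
        using eventually_ge_at_top[of k0] by eventually_elim (use k0 in auto)
      then show "(\<lambda>k. f y * indicator {y. norm y > real k} y) \<longlonglongrightarrow> 0"
        by (rule tendsto_eventually)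
    qed
  qed (use f in \<open>auto simp: indicator_def\<close>)
  then have "\<forall>\<^sub>F k in sequentially. (\<integral>y. f y * indicator {y. norm y > real k} y \<partial>P) < \<delta>"
    using \<delta> by (intro order_tendstoD) auto
  then obtain k where "(\<integral>y. f y * indicator {y. norm y > real k} y \<partial>P) < \<delta>"
    using eventually_happens'[OF sequentially_bot] by blast
  then show ?thesis by (intro exI[of _ "real k"]) auto
qed

text \<open>The core is the bound \<open>pointwise\<close> on \<open>h y - h y'\<close>, integrated
  against the coupling. If \<open>y'\<close> is far out, the tail of the growth function under
  \<open>P\<close> pays; if \<open>y'\<close> is in the ball and \<open>y\<close> is close, uniform
  continuity on a compact set pays; if \<open>y\<close> is at distance more than
  \<open>\<eta>\<close>, the transport cost pays, with factor \<open>L\<close>. The resulting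
  \<open>r\<close> is uniform in \<open>Q\<close>.\<close>

lemma expectation_le_of_coupling_cost_le:
  fixes P :: "'y::euclidean_space measure" and h :: "'y \<Rightarrow> real"
  assumes p: "p \<ge> 1" and P: "prob_space P" "sets P = sets borel"
    and S: "closed S" "AE y in P. y \<in> S"
    and moment: "integrable P (\<lambda>y. norm y powr p)"
    and h: "h \<in> borel_measurable borel" "continuous_on S h"
    and growth: "B \<ge> 0" "\<And>y. y \<in> S \<Longrightarrow> \<bar>h y\<bar> \<le> B * (1 + norm y powr p)"
    and \<delta>: "\<delta> > 0"
  shows "\<exists>r>0. \<forall>Q. \<forall>\<pi>\<in>couplings Q P. (AE y in Q. y \<in> S) \<longrightarrow>
    coupling_cost p \<pi> \<le> ennreal (r powr p) \<longrightarrow> (\<integral>y. h y \<partial>Q) \<le> (\<integral>y. h y \<partial>P) + \<delta>"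
proof -
  interpret P: prob_space P by (rule P)
  \<comment> \<open>\<open>K\<close> dominates the coefficients \<open>2 * B\<close>,
    \<open>B * 2 powr p\<close> and \<open>B * (2 powr p + 1)\<close> that arise in
    \<open>diff\<close>.\<close>
  define K where "K = B * (2 powr p + 2)"
  define w where "w y = 1 + norm y powr p" for y :: 'y
  have w0: "w y \<ge> 1" for y by (simp add: w_def)
  have K0: "K \<ge> 0" using growth(1) by (simp add: K_def)
  have [measurable]: "h \<in> borel_measurable borel" by (rule h)
  have wm[measurable]: "w \<in> borel_measurable borel" unfolding w_def by measurable
  have iw: "integrable P w" unfolding w_def using moment by simp
  obtain R where R: "R \<ge> 0" "(\<integral>y. K * w y * indicator {y. norm y > R} y \<partial>P) \<le> \<delta> / 4"
    using integrable_tail_small[OF P(2), of "\<lambda>y. K * w y" "\<delta> / 4"] iw \<delta> by auto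
  \<comment> \<open>The extra unit of radius accommodates \<open>y\<close> when
    \<open>norm y' \<le> R\<close> and \<open>norm (y - y') \<le> \<eta> \<le> 1\<close>.\<close>
  have "compact (S \<inter> cball 0 (R + 1))" using S(1) by (simp add: closed_Int_compact)
  moreover have "continuous_on (S \<inter> cball 0 (R + 1)) h"
    using h(2) by (rule continuous_on_subset) auto
  ultimately have "uniformly_continuous_on (S \<inter> cball 0 (R + 1)) h"
    by (rule compact_uniformly_continuous[rotated])
  then obtain \<eta>0 where \<eta>0: "\<eta>0 > 0" "\<And>x x'. x \<in> S \<inter> cball 0 (R + 1) \<Longrightarrow>
      x' \<in> S \<inter> cball 0 (R + 1) \<Longrightarrow> dist x' x < \<eta>0 \<Longrightarrow> dist (h x') (h x) < \<delta> / 4"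
    unfolding uniformly_continuous_on_def using \<delta> by (metis zero_less_divide_iff zero_less_numeral)
  define \<eta> where "\<eta> = min 1 (\<eta>0 / 2)"
  have \<eta>: "\<eta> > 0" "\<eta> \<le> 1" "\<eta> < \<eta>0" using \<eta>0(1) by (auto simp: \<eta>_def)
  \<comment> \<open>The first summand absorbs the distance term of \<open>diff\<close>. The second
    absorbs \<open>K * w y'\<close> for separated pairs, since there
    \<open>w y' \<le> 1 + R powr p\<close> and \<open>norm (y - y') powr p / \<eta> powr p\<close>
    is at least 1.\<close>
  define L where "L = K + K * (1 + R powr p) / \<eta> powr p"
  have L0: "L \<ge> 0" using K0 \<eta> by (auto simp: L_def intro!: add_nonneg_nonneg divide_nonneg_nonneg)
  have crude: "\<bar>h y\<bar> \<le> B + B * 2 powr p * norm (y - y') powr p + B * 2 powr p * norm y' powr p"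
    if "y \<in> S" for y y'
  proof -
    have "norm y powr p \<le> (norm (y - y') + norm y') powr p"
      using norm_triangle_ineq[of "y - y'" y'] p by (intro powr_mono2) auto
    also have "\<dots> \<le> 2 powr p * (norm (y - y') powr p + norm y' powr p)"
      using p by (intro powr_add_le) auto
    finally have "B * (1 + norm y powr p) \<le> B * (1 + 2 powr p * (norm (y - y') powr p + norm y' powr p))"
      using growth(1) by (intro mult_left_mono) auto
    then show ?thesis using growth(2)[OF that] by (simp add: algebra_simps)
  qed
  have diff: "h y - h y' \<le> K * w y' + K * norm (y - y') powr p" if "y \<in> S" "y' \<in> S" for y y'
  proof -
    have "h y - h y' \<le> B * 2 + B * 2 powr p * norm (y - y') powr p + B * (2 powr p + 1) * norm y' powr p"
      using crude[OF that(1), of y'] growth(2)[OF that(2)] by (simp add: algebra_simps)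
    also have "\<dots> \<le> K * 1 + K * norm (y - y') powr p + K * norm y' powr p"
      unfolding K_def using growth(1)
      by (intro add_mono mult_right_mono) (auto intro: mult_left_mono)
    finally show ?thesis by (simp add: w_def algebra_simps)
  qed
  have pointwise: "h y - h y' \<le> \<delta> / 4 + K * w y' * indicator {y. norm y > R} y' + L * norm (y - y') powr p"
    if "y \<in> S" "y' \<in> S" for y y'
  proof (cases "norm y' > R")
    case True
    have "K * norm (y - y') powr p \<le> L * norm (y - y') powr p"
      using K0 \<eta> by (intro mult_right_mono) (auto simp: L_def)
    then show ?thesis using diff[OF that] True \<delta> by simp
  next
    case False
    have Ln: "L * norm (y - y') powr p \<ge> 0" using L0 by simp
    show ?thesis
    proof (cases "norm (y - y') \<le> \<eta>")
      case True
      have "norm y \<le> R + 1"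
        using False True \<eta>(2) norm_triangle_ineq[of "y - y'" y'] by simp
      then have "dist (h y) (h y') < \<delta> / 4"
        using that False True \<eta> by (intro \<eta>0(2)) (auto simp: dist_norm)
      then have "h y - h y' < \<delta> / 4" by (simp only: dist_real_def abs_less_iff)
      then show ?thesis using False Ln by simp
    next
      case far: False
      have "w y' \<le> 1 + R powr p"
        using False p by (auto simp: w_def intro!: powr_mono2)
      moreover have "1 \<le> norm (y - y') powr p / \<eta> powr p"
        using far \<eta> p by (simp add: powr_mono2)
      ultimately have "w y' * 1 \<le> (1 + R powr p) * (norm (y - y') powr p / \<eta> powr p)"
        using w0[of y'] by (intro mult_mono) auto
      then have "K * (w y' * 1) \<le> K * ((1 + R powr p) * (norm (y - y') powr p / \<eta> powr p))"
        using K0 by (rule mult_left_mono)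
      then have "K * w y' + K * norm (y - y') powr p \<le> L * norm (y - y') powr p"
        by (simp add: L_def algebra_simps)
      then show ?thesis using diff[OF that] False \<delta> by simp
    qed
  qed
  \<comment> \<open>Chosen so that \<open>L * r powr p \<le> \<delta> / 4\<close>; the denominator
    has \<open>L + 1\<close> because \<open>L\<close> may be 0.\<close>
  define r where "r = (\<delta> / (4 * (L + 1))) powr (1 / p)"
  have rp: "r powr p = \<delta> / (4 * (L + 1))"
    using p \<delta> L0 by (simp add: r_def powr_powr)
  have Lr: "L * r powr p \<le> \<delta> / 4"
  proof -
    have "L * r powr p = \<delta> / 4 * (L / (L + 1))"
      by (simp add: rp)
    also have "\<dots> \<le> \<delta> / 4 * 1" using \<delta> L0 by (intro mult_left_mono) auto
    finally show ?thesis by simp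
  qed
  show ?thesis
  proof (intro exI[of _ r] conjI allI ballI impI)
    show "r > 0" using \<delta> L0 by (simp add: r_def)
    fix Q \<pi> assume \<pi>: "\<pi> \<in> couplings Q P" and QS: "AE y in Q. y \<in> S"
      and cost: "coupling_cost p \<pi> \<le> ennreal (r powr p)"
    note c = couplingsD[OF \<pi>]
    interpret \<pi>: prob_space \<pi> by (rule c)
    note [measurable_cong] = c(2)
    have [measurable]: "fst \<in> measurable \<pi> borel" "snd \<in> measurable \<pi> borel" by (rule c)+
    have S': "{x \<in> space borel. x \<in> S} \<in> sets borel" using S(1) by simp
    have AE1: "AE x in \<pi>. fst x \<in> S"
      using QS unfolding c(5)[symmetric] by (subst (asm) AE_distr_iff[OF c(7) S'])
    have AE2: "AE x in \<pi>. snd x \<in> S"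
      using S(2) unfolding c(6)[symmetric] by (subst (asm) AE_distr_iff[OF c(8) S'])
    let ?d = "\<lambda>x. norm (fst x - snd x) powr p"
    have dm[measurable]: "?d \<in> borel_measurable \<pi>" by measurable
    have cost': "(\<integral>\<^sup>+x. ennreal (?d x) \<partial>\<pi>) \<le> ennreal (r powr p)"
      using cost by (simp add: case_prod_unfold)
    have id: "integrable \<pi> ?d"
      using cost' by (intro integrableI_bounded) (auto simp: le_less_trans[OF _ ennreal_less_top])
    have "ennreal (\<integral>x. ?d x \<partial>\<pi>) \<le> ennreal (r powr p)"
      using cost' by (subst nn_integral_eq_integral[OF id, symmetric]) auto
    then have dle: "(\<integral>x. ?d x \<partial>\<pi>) \<le> r powr p" by simp
    have distrP: "distr \<pi> borel snd = P" and distrQ: "distr \<pi> borel fst = Q" by (rule c)+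
    have snd_int: "integrable \<pi> (\<lambda>x. f (snd x))" "(\<integral>x. f (snd x) \<partial>\<pi>) = (\<integral>y. f y \<partial>P)"
      if "integrable P f" "f \<in> borel_measurable borel" for f :: "'y \<Rightarrow> real"
      using that(1) unfolding distrP[symmetric]
      by (simp_all only: integrable_distr_eq[OF c(8) that(2)] integral_distr[OF c(8) that(2)])
    have ih: "integrable P h"
    proof (rule Bochner_Integration.integrable_bound)
      show "integrable P (\<lambda>y. B * w y)" using iw by simp
      show "h \<in> borel_measurable P" using h(1) P(2) by (simp cong: measurable_cong_sets)
      show "AE y in P. norm (h y) \<le> norm (B * w y)"
        using S(2) by eventually_elim (use growth w0 in \<open>auto simp: w_def\<close>)
    qed
    \<comment> \<open>No moment of \<open>Q\<close> is assumed: \<open>crude\<close> bounds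
      \<open>h\<close> at the first coordinate by the transport cost and the moment of
      \<open>P\<close>. Integrability is what allows the difference of expectations to be written as
      one integral.\<close>
    have ihQ: "integrable \<pi> (\<lambda>x. h (fst x))"
    proof (rule Bochner_Integration.integrable_bound)
      show "integrable \<pi> (\<lambda>x. B + B * 2 powr p * ?d x + B * 2 powr p * norm (snd x) powr p)"
        using id snd_int(1)[OF moment] by simp
      show "AE x in \<pi>. norm (h (fst x))
          \<le> norm (B + B * 2 powr p * ?d x + B * 2 powr p * norm (snd x) powr p)"
        using AE1
      proof eventually_elim
        case (elim x)
        from crude[OF elim, of "snd x"] show ?case by (simp add: abs_of_nonneg growth(1))
      qed
    qed measurable
    define tl where "tl y = K * w y * indicator {y. norm y > R} y" for y
    have tlm[measurable]: "tl \<in> borel_measurable borel" unfolding tl_def by measurable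
    have itl: "integrable P tl"
    proof (rule Bochner_Integration.integrable_bound)
      show "integrable P (\<lambda>y. K * w y)" using iw by simp
      show "tl \<in> borel_measurable P" using tlm P(2) by (simp cong: measurable_cong_sets)
      show "AE y in P. norm (tl y) \<le> norm (K * w y)"
        by (intro AE_I2) (auto simp: tl_def indicator_def)
    qed
    have "(\<integral>y. h y \<partial>Q) - (\<integral>y. h y \<partial>P) = (\<integral>x. h (fst x) - h (snd x) \<partial>\<pi>)"
      using ihQ snd_int[OF ih h(1)] unfolding distrQ[symmetric]
      by (simp add: integral_distr[OF c(7) h(1)])
    also have "\<dots> \<le> (\<integral>x. \<delta> / 4 + tl (snd x) + L * ?d x \<partial>\<pi>)"
    proof (rule integral_mono_AE)
      show "AE x in \<pi>. h (fst x) - h (snd x) \<le> \<delta> / 4 + tl (snd x) + L * ?d x"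
        using AE1 AE2 by eventually_elim (use pointwise in \<open>auto simp: tl_def\<close>)
    qed (use ihQ snd_int(1)[OF ih h(1)] snd_int(1)[OF itl tlm] id in auto)
    also have "\<dots> = \<delta> / 4 + (\<integral>y. tl y \<partial>P) + L * (\<integral>x. ?d x \<partial>\<pi>)"
      using snd_int[OF itl tlm] id by (simp add: \<pi>.prob_space)
    also have "\<dots> \<le> \<delta> / 4 + \<delta> / 4 + \<delta> / 4"
      using R(2) Lr mult_left_mono[OF dle L0] by (intro add_mono) (auto simp: tl_def)
    finally show "(\<integral>y. h y \<partial>Q) \<le> (\<integral>y. h y \<partial>P) + \<delta>"
      using \<delta> by simp
  qed
qed

section \<open>Lower semicontinuity and near-minimizers\<close>

lemma lsc_on_subset: "lsc_on S f \<Longrightarrow> T \<subseteq> S \<Longrightarrow> lsc_on T f"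
  unfolding lsc_on_def using at_le[of T S] by (meson filter_leD subsetD)

lemma closed_sublevel_lsc_on:
  assumes "closed S" "lsc_on S f"
  shows "closed {x \<in> S. f x \<le> t}"
  unfolding closed_def
proof (subst open_subopen, rule ballI)
  fix x assume x: "x \<in> - {x \<in> S. f x \<le> t}"
  show "\<exists>T. open T \<and> x \<in> T \<and> T \<subseteq> - {x \<in> S. f x \<le> t}"
  proof (cases "x \<in> S")
    case True
    then have "\<forall>\<^sub>F y in at x within S. t < f y"
      using x assms(2) by (auto simp: lsc_on_def)
    then obtain U where "open U" "x \<in> U" "\<forall>y\<in>U. y \<noteq> x \<longrightarrow> y \<in> S \<longrightarrow> t < f y"
      unfolding eventually_at_topological by blast
    then show ?thesis using x by (intro exI[of _ U]) fastforce
  next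
    case False
    then show ?thesis using assms(1) by (intro exI[of _ "- S"]) auto
  qed
qed

text \<open>Sublevel sets of \<open>f\<close> within \<open>S\<close> are closed, and since
  \<open>W\<close> stays in \<open>S\<close> the events \<open>f (W \<omega>) \<le> t\<close> are
  their preimages.\<close>

lemma borel_measurable_lsc_on:
  assumes f: "closed S" "lsc_on S f"
    and W: "W \<in> borel_measurable M" "\<And>\<omega>. \<omega> \<in> space M \<Longrightarrow> W \<omega> \<in> S"
  shows "(\<lambda>\<omega>. f (W \<omega>)) \<in> borel_measurable M"
  unfolding borel_measurable_iff_le
proof
  fix t
  have "W -` {x \<in> S. f x \<le> t} \<inter> space M \<in> sets M"
    by (intro measurable_sets[OF W(1)] borel_closed closed_sublevel_lsc_on f)
  also have "W -` {x \<in> S. f x \<le> t} \<inter> space M = {\<omega> \<in> space M. f (W \<omega>) \<le> t}"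
    using W(2) by auto
  finally show "{\<omega> \<in> space M. f (W \<omega>) \<le> t} \<in> sets M" .
qed

lemma minimizersD: "z \<in> minimizers Z f \<Longrightarrow> z \<in> Z" "z \<in> minimizers Z f \<Longrightarrow> w \<in> Z \<Longrightarrow> f z \<le> f w"
  by (auto simp: minimizers_def is_arg_min_def not_less)

lemma min_value_minimizer: "z \<in> minimizers Z f \<Longrightarrow> min_value Z f = f z"
  unfolding min_value_def by (intro cInf_eq_minimum) (auto dest: minimizersD)

text \<open>The points of \<open>Z\<close> at distance at least \<open>\<eta>\<close> from the
  minimizers form a compact set \<open>K\<close>. If \<open>K\<close> is nonempty, \<open>f\<close>
  attains a minimum on it, which must exceed the global one; half of this gap serves as
  \<open>\<delta>\<close>.\<close>

lemma near_minimizers: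
  fixes Z :: "'z::euclidean_space set"
  assumes Z: "compact Z" "Z \<noteq> {}" "lsc_on Z f" and \<eta>: "\<eta> > 0"
  shows "\<exists>\<delta>>0. \<forall>z\<in>Z. f z \<le> min_value Z f + \<delta> \<longrightarrow> infdist z (minimizers Z f) \<le> \<eta>"
proof -
  define K where "K = {z \<in> Z. infdist z (minimizers Z f) \<ge> \<eta>}"
  obtain m where m: "m \<in> minimizers Z f" "min_value Z f = f m"
    using min_value_attained[OF Z] by blast
  show ?thesis
  proof (cases "K = {}")
    case True
    then show ?thesis
      unfolding K_def by (intro exI[of _ 1]) fastforce
  next
    case False
    have "closed {z. infdist z (minimizers Z f) \<ge> \<eta>}"
      by (intro closed_Collect_le continuous_intros)
    then have "compact (Z \<inter> {z. infdist z (minimizers Z f) \<ge> \<eta>})"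
      by (rule compact_Int_closed[OF Z(1)])
    then have "compact K" by (simp add: K_def Int_def)
    then obtain k where k: "k \<in> minimizers K f"
      using min_value_attained[of K f] False lsc_on_subset[OF Z(3), of K] by (auto simp: K_def)
    then have kK: "k \<in> K" by (rule minimizersD)
    have "f m < f k"
    proof (rule ccontr)
      assume "\<not> f m < f k"
      then have "k \<in> minimizers Z f"
        using m kK minimizersD(2)[OF m(1)] by (force simp: minimizers_def is_arg_min_def K_def)
      then show False using kK \<eta> by (simp add: K_def)
    qed
    moreover have "infdist z (minimizers Z f) \<le> \<eta>" if "z \<in> Z" "f z < f k" for z
      using minimizersD(2)[OF k, of z] that by (force simp: K_def)
    ultimately show ?thesis
      by (intro exI[of _ "(f k - f m) / 2"]) (auto simp: m(2) field_simps)
  qed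
qed

section \<open>Calibration of the concentration radius\<close>

text \<open>With \<open>t = ln (2 * C / \<alpha>) / (c0 * n)\<close>, the case distinction on
  \<open>n\<close> is the one on \<open>t \<le> 1\<close>, and it agrees with the one on whether the
  radius is at most 1. In each case the exponents of \<open>kappa2\<close> and
  \<open>concentration_bound\<close> are reciprocal, so the powers cancel and leave
  \<open>C * exp (- c0 * n * t) = \<alpha> / 2\<close>.\<close>

lemma kappa2_pos_and_concentration_bound:
  assumes C: "C \<ge> 1" and c0: "c0 > 0" and \<alpha>: "0 < \<alpha>" "\<alpha> < 1" and n: "n \<ge> 1"
    and p: "p > 0" and a: "a > 0" and d: "d \<ge> 1"
  shows "kappa2 C c0 a p d n \<alpha> > 0"
    and "concentration_bound C c0 a p d n (kappa2 C c0 a p d n \<alpha>) = \<alpha> / 2"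
proof -
  define l where "l = ln (2 * C / \<alpha>)"
  have "1 * \<alpha> < 2 * C" using C \<alpha> by simp
  then have l: "l > 0" using \<alpha> by (simp add: l_def)
  define t where "t = l / (c0 * real n)"
  have t: "t > 0" using l c0 n by (simp add: t_def)
  have expl: "C * exp (- c0 * real n * t) = \<alpha> / 2"
  proof -
    have "- c0 * real n * t = - l" using c0 n by (simp add: t_def)
    then show ?thesis using C \<alpha> by (simp add: l_def exp_minus)
  qed
  have small_iff: "real n \<ge> l / c0 \<longleftrightarrow> t \<le> 1"
    using c0 n by (simp add: t_def field_simps)
  have k: "kappa2 C c0 a p d n \<alpha>
      = (if t \<le> 1 then t powr min (p / real d) (1 / 2) else t powr (p / a))"
    unfolding kappa2_def l_def[symmetric] small_iff t_def[symmetric] ..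
  show "kappa2 C c0 a p d n \<alpha> > 0" using t by (simp add: k)
  show "concentration_bound C c0 a p d n (kappa2 C c0 a p d n \<alpha>) = \<alpha> / 2"
  proof (cases "t \<le> 1")
    case True
    have "min (p / real d) (1 / 2) * max (real d / p) 2 = 1"
      using p d by (auto simp: min_def max_def field_simps)
    moreover have "t powr min (p / real d) (1 / 2) \<le> 1"
      using True t p by (intro powr_le1) auto
    ultimately show ?thesis
      using True t expl by (simp add: k concentration_bound_def powr_powr)
  next
    case False
    then have "t powr (p / a) > 1" using p a by (intro gr_one_powr) auto
    then have "\<not> t powr (p / a) \<le> 1" by simp
    then show ?thesis
      using False t p a expl by (simp add: k concentration_bound_def powr_powr)
  qed
qed

section \<open>Moments of the error and its independence of the covariate\<close>

lemma integrable_norm_powr_add: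
  fixes Q :: "'y::euclidean_space measure"
  assumes p: "p \<ge> 1" and Q: "prob_space Q" "sets Q = sets borel"
    and moment: "integrable Q (\<lambda>e. norm e powr p)"
  shows "integrable Q (\<lambda>e. norm (v + e) powr p)"
proof (rule Bochner_Integration.integrable_bound)
  interpret prob_space Q by (rule Q)
  show "integrable Q (\<lambda>e. 2 powr p * (norm v powr p + norm e powr p))"
    using moment by simp
  show "(\<lambda>e. norm (v + e) powr p) \<in> borel_measurable Q"
    unfolding measurable_cong_sets[OF Q(2) refl] by measurable
  show "AE e in Q. norm (norm (v + e) powr p) \<le> norm (2 powr p * (norm v powr p + norm e powr p))"
  proof (intro AE_I2)
    fix e
    have "norm (v + e) powr p \<le> (norm v + norm e) powr p"
      using p by (intro powr_mono2 norm_triangle_ineq) auto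
    also have "\<dots> \<le> 2 powr p * (norm v powr p + norm e powr p)"
      using p by (intro powr_add_le) auto
    finally show "norm (norm (v + e) powr p) \<le> norm (2 powr p * (norm v powr p + norm e powr p))"
      by (simp add: abs_of_nonneg)
  qed
qed

text \<open>Turns the exponential moment of order \<open>a\<close> into a finite moment of order
  \<open>p\<close>.\<close>

lemma powr_le_exp_powr:
  fixes u :: real
  assumes "0 < p" "p < a" "u \<ge> 0"
  shows "u powr p \<le> exp (u powr a)"
proof (cases "u \<le> 1")
  case True
  then have "u powr p \<le> 1" using assms by (intro powr_le1) auto
  also have "1 \<le> exp (u powr a)" by simp
  finally show ?thesis .
next
  case False
  then have "u powr p \<le> u powr a" using assms by (intro powr_mono) auto
  also have "\<dots> \<le> exp (u powr a)" using exp_ge_add_one_self[of "u powr a"] by linarith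
  finally show ?thesis .
qed

text \<open>The library's \<open>indep_var\<close> forces both random variables to have the same type, so
  independence is stated here through the generated set systems.\<close>
lemma (in prob_space) AE_AE_of_indep_set:
  assumes X: "X \<in> measurable M S" and E: "E \<in> measurable M T"
    and ind: "indep_set {X -` A \<inter> space M | A. A \<in> sets S} {E -` A \<inter> space M | A. A \<in> sets T}"
    and W: "{w \<in> space (S \<Otimes>\<^sub>M T). R (fst w) (snd w)} \<in> sets (S \<Otimes>\<^sub>M T)"
    and AE: "AE \<omega> in M. R (X \<omega>) (E \<omega>)"
  shows "AE x in distr M S X. AE e in distr M T E. R x e"
proof -
  interpret X: prob_space "distr M S X" by (rule prob_space_distr[OF X])
  interpret E: prob_space "distr M T E" by (rule prob_space_distr[OF E])
  interpret XE: pair_prob_space "distr M S X" "distr M T E" ..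
  have m: "(\<lambda>x. (X x, E x)) \<in> measurable M (S \<Otimes>\<^sub>M T)" using X E by simp
  \<comment> \<open>Independence is agreement on rectangles, which identifies the joint law with the
    product; Fubini for null sets then separates the two variables.\<close>
  have joint: "distr M S X \<Otimes>\<^sub>M distr M T E = distr M (S \<Otimes>\<^sub>M T) (\<lambda>x. (X x, E x))"
  proof (rule pair_measure_eqI)
    fix A B assume "A \<in> sets (distr M S X)" "B \<in> sets (distr M T E)"
    then have A: "A \<in> sets S" and B: "B \<in> sets T" by simp_all
    have "prob (X -` A \<inter> space M \<inter> (E -` B \<inter> space M)) = prob (X -` A \<inter> space M) * prob (E -` B \<inter> space M)"
      using A B by (intro indep_setD[OF ind]) auto
    moreover have "(\<lambda>x. (X x, E x)) -` (A \<times> B) \<inter> space M = X -` A \<inter> space M \<inter> (E -` B \<inter> space M)"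
      by auto
    ultimately show "emeasure (distr M S X) A * emeasure (distr M T E) B
        = emeasure (distr M (S \<Otimes>\<^sub>M T) (\<lambda>x. (X x, E x))) (A \<times> B)"
      using A B by (simp add: emeasure_distr[OF X] emeasure_distr[OF E] emeasure_distr[OF m]
        emeasure_eq_measure ennreal_mult)
  qed (simp_all add: X.sigma_finite_measure_axioms E.sigma_finite_measure_axioms)
  have "AE w in distr M S X \<Otimes>\<^sub>M distr M T E. R (fst w) (snd w)"
    unfolding joint by (subst AE_distr_iff[OF m W]) (simp add: AE)
  from XE.AE_pair[OF this] show ?thesis by simp
qed

section \<open>Convergence in probability\<close>

text \<open>The events \<open>bad n\<close> do not depend on \<open>\<delta>\<close>: for each level
  the deviation event is eventually contained in \<open>bad n\<close>, so its probability is
  squeezed to 0.\<close>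

lemma (in prob_space) tendsto_in_probI:
  assumes V: "\<And>n. n \<ge> 1 \<Longrightarrow> V n \<in> borel_measurable M"
    and bad: "\<And>n. n \<ge> 1 \<Longrightarrow> bad n \<in> events" "(\<lambda>n. prob (bad n)) \<longlonglongrightarrow> 0"
    and close: "\<And>\<delta>. \<delta> > 0 \<Longrightarrow>
      \<forall>\<^sub>F n in sequentially. \<forall>\<omega>\<in>space M - bad n. \<bar>V n \<omega> - l\<bar> \<le> \<delta>"
  shows "tendsto_in_prob M V l"
  unfolding tendsto_in_prob_def
proof (intro conjI allI impI)
  show "\<forall>\<^sub>F n in sequentially. V n \<in> borel_measurable M"
    using eventually_ge_at_top[of 1] by eventually_elim (rule V)
  fix \<delta> :: real assume "\<delta> > 0"
  from close[OF this] eventually_ge_at_top[of 1]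
  have "\<forall>\<^sub>F n in sequentially. prob {\<omega> \<in> space M. \<bar>V n \<omega> - l\<bar> > \<delta>} \<le> prob (bad n)"
  proof eventually_elim
    case (elim n)
    then show ?case by (intro finite_measure_mono bad(1)) force+
  qed
  then show "(\<lambda>n. prob {\<omega> \<in> space M. \<bar>V n \<omega> - l\<bar> > \<delta>}) \<longlonglongrightarrow> 0"
    by (intro tendsto_sandwich[OF _ _ tendsto_const bad(2)]) auto
qed

section \<open>Couplings with the residual empirical measure\<close>

text \<open>The projection fixes the full-information points, which lie in \<open>S\<close>, and is
  nonexpansive. Hence matched points differ by at most the estimation error at \<open>x\<close> plus
  the one at \<open>xi i\<close>. Each error has p-mean at most \<open>k\<close>, and the two bounds
  add up to \<open>2 * k\<close>.\<close>

lemma full_info_residual_coupling: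
  fixes f fh :: "'x \<Rightarrow> 'y::euclidean_space"
  assumes p: "p \<ge> 1" and n: "n \<ge> 1" and S: "closed S" "convex S" and k: "k > 0"
    and reg: "norm (f x - fh x) powr p \<le> k powr p"
      "(1 / real n) * (\<Sum>i=1..n. norm (f (xi i) - fh (xi i)) powr p) \<le> k powr p"
    and supp: "\<And>i. i \<in> {1..n} \<Longrightarrow> f x + (yi i - f (xi i)) \<in> S"
  shows "\<exists>\<pi>\<in>couplings (full_info_empirical f n yi xi x) (residual_empirical S fh n yi xi x).
    coupling_cost p \<pi> \<le> ennreal ((2 * k) powr p)"
proof -
  define h where "h i = f x + (yi i - f (xi i))" for i
  define h' where "h' i = closest_point S (fh x + (yi i - fh (xi i)))" for i
  \<comment> \<open>This is \<open>2 powr (p - 1)\<close>, written so that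
    \<open>a * k powr p + a * k powr p = (2 * k) powr p\<close> is immediate.\<close>
  define a where "a = (2 * k) powr p / (2 * k powr p)"
  let ?u = "norm (f x - fh x)" and ?v = "\<lambda>i. norm (f (xi i) - fh (xi i))"
  have a0: "a \<ge> 0" by (simp add: a_def)
  have le: "norm (h i - h' i) powr p \<le> a * ?u powr p + a * ?v i powr p" if i: "i \<in> {1..n}" for i
  proof -
    have hS: "h i \<in> S" using supp[OF i] by (simp add: h_def)
    have "norm (h i - h' i) = dist (closest_point S (h i)) (h' i)"
      using closest_point_self[OF hS] by (simp add: dist_norm)
    also have "\<dots> \<le> dist (h i) (fh x + (yi i - fh (xi i)))"
      unfolding h'_def using hS S by (intro closest_point_lipschitz) auto
    also have "\<dots> = norm ((f x - fh x) - (f (xi i) - fh (xi i)))"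
      by (simp add: dist_norm h_def algebra_simps)
    also have "\<dots> \<le> ?u + ?v i" by (rule norm_triangle_ineq4)
    finally have "norm (h i - h' i) powr p \<le> (?u + ?v i) powr p"
      using p by (intro powr_mono2) auto
    also have "\<dots> \<le> (k + k) powr p * (k / (k + k) * (?u powr p / k powr p) + k / (k + k) * (?v i powr p / k powr p))"
      using p k by (intro powr_add_weighted_le) auto
    also have "\<dots> = a * ?u powr p + a * ?v i powr p"
      using k by (simp add: a_def field_simps)
    finally show ?thesis .
  qed
  have "(\<Sum>i=1..n. norm (h i - h' i) powr p) / real n
      \<le> (\<Sum>i=1..n. a * ?u powr p + a * ?v i powr p) / real n"
    using n le by (intro divide_right_mono sum_mono) auto
  also have "\<dots> = a * ?u powr p + a * ((1 / real n) * (\<Sum>i=1..n. ?v i powr p))"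
    using n by (simp add: sum.distrib sum_distrib_left[symmetric] field_simps)
  also have "\<dots> \<le> a * k powr p + a * k powr p"
    using reg a0 by (intro add_mono mult_left_mono)
  also have "\<dots> = (2 * k) powr p" using k by (simp add: a_def)
  finally have le_cost: "(\<Sum>i=1..n. norm (h i - h' i) powr p) / real n \<le> (2 * k) powr p" .
  obtain \<pi> where "\<pi> \<in> couplings (empirical n h) (empirical n h')"
    "coupling_cost p \<pi> = ennreal ((\<Sum>i=1..n. norm (h i - h' i) powr p) / real n)"
    using empirical_coupling[OF n] by blast
  with le_cost have "\<exists>\<pi>\<in>couplings (empirical n h) (empirical n h').
      coupling_cost p \<pi> \<le> ennreal ((2 * k) powr p)"
    by (intro bexI[of _ \<pi>]) (simp_all only: ennreal_leI)
  moreover have "full_info_empirical f n yi xi x = empirical n h"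
    "residual_empirical S fh n yi xi x = empirical n h'"
    by (simp_all add: full_info_empirical_def residual_empirical_def h_def[abs_def] h'_def[abs_def])
  ultimately show ?thesis by simp
qed

text \<open>Glue along the full-information empirical measure: as the middle marginal it is atomic,
  as \<open>couplings_glue\<close> requires, and the two radii add.\<close>

lemma law_residual_coupling:
  fixes f fh :: "'x \<Rightarrow> 'y::euclidean_space"
  assumes p: "p \<ge> 1" and n: "n \<ge> 1" and S: "closed S" "convex S" and k: "k > 0" "k' > 0"
    and reg: "norm (f x - fh x) powr p \<le> k powr p"
      "(1 / real n) * (\<Sum>i=1..n. norm (f (xi i) - fh (xi i)) powr p) \<le> k powr p"
    and supp: "\<And>i. i \<in> {1..n} \<Longrightarrow> f x + (yi i - f (xi i)) \<in> S"
    and W: "wasserstein p (full_info_empirical f n yi xi x) P < ennreal k'"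
  shows "\<exists>\<pi>\<in>couplings P (residual_empirical S fh n yi xi x).
    coupling_cost p \<pi> \<le> ennreal ((2 * k + k') powr p)"
proof -
  obtain \<pi> where \<pi>: "\<pi> \<in> couplings (full_info_empirical f n yi xi x) P"
      "coupling_cost p \<pi> \<le> ennreal (k' powr p)"
    using wasserstein_lessD[OF p W] by blast
  obtain \<rho> where \<rho>: "\<rho> \<in> couplings (full_info_empirical f n yi xi x) (residual_empirical S fh n yi xi x)"
      "coupling_cost p \<rho> \<le> ennreal ((2 * k) powr p)"
    using full_info_residual_coupling[OF p n S k(1) reg supp] by blast
  have atoms: "AE y in full_info_empirical f n yi xi x. emeasure (full_info_empirical f n yi xi x) {y} \<noteq> 0"
    unfolding full_info_empirical_def by (rule AE_empirical_atom)
  have c: "coupling_cost p (distr \<pi> (borel \<Otimes>\<^sub>M borel) (\<lambda>(a, b). (b, a))) \<le> ennreal (k' powr p)"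
    unfolding couplings_swap(2)[OF \<pi>(1)] by (rule \<pi>(2))
  have "\<exists>\<sigma>\<in>couplings P (residual_empirical S fh n yi xi x).
    coupling_cost p \<sigma> \<le> ennreal ((k' + 2 * k) powr p)"
    using k by (intro couplings_glue[OF p _ _ couplings_swap(1)[OF \<pi>(1)] \<rho>(1) atoms c \<rho>(2)]) auto
  then show ?thesis by (simp only: add.commute)
qed

text \<open>Membership in the ball is a non-strict bound, so the radius is relaxed to
  \<open>2 * \<zeta>\<close> to obtain an actual coupling. Gluing along the empirical measure adds
  the remaining \<open>\<zeta>\<close>.\<close>

lemma wasserstein_ball_coupling:
  assumes p: "p \<ge> 1" and \<zeta>: "\<zeta> > 0"
    and Q: "Q \<in> wasserstein_ball p S (empirical n h) \<zeta>"
    and \<pi>: "\<pi> \<in> couplings P (empirical n h)" "coupling_cost p \<pi> \<le> ennreal (\<zeta> powr p)"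
  shows "\<exists>\<rho>\<in>couplings Q P. coupling_cost p \<rho> \<le> ennreal ((3 * \<zeta>) powr p)"
proof -
  have "wasserstein p Q (empirical n h) \<le> ennreal \<zeta>" using Q by (simp add: wasserstein_ball_def)
  also have "\<dots> < ennreal (2 * \<zeta>)" using \<zeta> by (simp add: ennreal_less_iff)
  finally obtain \<rho> where \<rho>: "\<rho> \<in> couplings Q (empirical n h)" "coupling_cost p \<rho> \<le> ennreal ((2 * \<zeta>) powr p)"
    using wasserstein_lessD[OF p] by blast
  have c: "coupling_cost p (distr \<pi> (borel \<Otimes>\<^sub>M borel) (\<lambda>(a, b). (b, a))) \<le> ennreal (\<zeta> powr p)"
    unfolding couplings_swap(2)[OF \<pi>(1)] by (rule \<pi>(2))
  have "\<exists>\<sigma>\<in>couplings Q P. coupling_cost p \<sigma> \<le> ennreal ((2 * \<zeta> + \<zeta>) powr p)"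
    using \<zeta> by (intro couplings_glue[OF p _ _ \<rho>(1) couplings_swap(1)[OF \<pi>(1)] AE_empirical_atom \<rho>(2) c]) auto
  then show ?thesis by simp
qed

section \<open>Consistency of the Wasserstein ER-DRO value and solutions\<close>

theorem theorem9:
  fixes N :: "'v measure" and M :: "'w measure"
    and X :: "'v \<Rightarrow> 'x::euclidean_space" and Y eps :: "'v \<Rightarrow> 'y::euclidean_space"
    and XX :: "'x set" and YY :: "'y set" and Z :: "'z::euclidean_space set"
    and PX :: "'x measure" and Pe :: "'y measure"
    and fstar :: "'x \<Rightarrow> 'y"
    and c :: "'z \<Rightarrow> 'y \<Rightarrow> real"
    and g :: "'z \<Rightarrow> 'x \<Rightarrow> real" and vstar :: "'x \<Rightarrow> real" and Sstar :: "'x \<Rightarrow> 'z set"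
    and xs :: "nat \<Rightarrow> 'w \<Rightarrow> 'x" and ys epss :: "nat \<Rightarrow> 'w \<Rightarrow> 'y"
    and reg :: "nat \<Rightarrow> (nat \<Rightarrow> 'y \<times> 'x) \<Rightarrow> 'x \<Rightarrow> 'y"
    and fhat :: "nat \<Rightarrow> 'w \<Rightarrow> 'x \<Rightarrow> 'y"
    and p a B C c0 :: real
    and kappa :: "nat \<Rightarrow> real \<Rightarrow> 'x \<Rightarrow> real"
    and zeta :: "nat \<Rightarrow> real \<Rightarrow> 'x \<Rightarrow> real"
    and alpha :: "nat \<Rightarrow> real"
    and Amb :: "nat \<Rightarrow> 'x \<Rightarrow> 'w \<Rightarrow> 'y measure set"
    and vhat :: "nat \<Rightarrow> 'x \<Rightarrow> 'w \<Rightarrow> real" and zhat :: "nat \<Rightarrow> 'x \<Rightarrow> 'w \<Rightarrow> 'z"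
  \<comment> \<open>population model\<close>
  assumes "prob_space N"
    and X: "X \<in> borel_measurable N" and eps: "eps \<in> borel_measurable N"
    and fstar: "fstar \<in> borel_measurable borel"
    and Y: "\<And>\<nu>. \<nu> \<in> space N \<Longrightarrow> Y \<nu> = fstar (X \<nu>) + eps \<nu>"
    and indep_X_eps: "prob_space.indep_set N
      {X -` A \<inter> space N | A. A \<in> sets borel} {eps -` A \<inter> space N | A. A \<in> sets borel}"
    and eps_mean: "integrable N eps" "(\<integral>\<nu>. eps \<nu> \<partial>N) = 0"
    and fstar_cond_exp: "\<And>b. b \<in> Basis \<Longrightarrow>
      AE \<nu> in N. real_cond_exp N (vimage_algebra (space N) X borel) (\<lambda>\<nu>. Y \<nu> \<bullet> b) \<nu>
        = fstar (X \<nu>) \<bullet> b"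
    and PX: "PX = distr N borel X" and Pe: "Pe = distr N borel eps"
    and XX: "XX = support_of PX"
    and YY: "YY = support_of (distr N borel Y)" "YY \<noteq> {}" "convex YY"
  \<comment> \<open>true problem\<close>
    and Z: "compact Z" "Z \<noteq> {}"
    and c_measurable: "\<And>z. z \<in> Z \<Longrightarrow> c z \<in> borel_measurable borel"
    and c_integrable: "\<And>z. z \<in> Z \<Longrightarrow> AE x in PX. integrable Pe (\<lambda>e. c z (fstar x + e))"
    and g: "\<And>z x. g z x = true_objective c fstar Pe z x"
    and g_lsc: "AE x in PX. lsc_on Z (\<lambda>z. g z x)"
    and vstar: "\<And>x. vstar x = min_value Z (\<lambda>z. g z x)"
    and Sstar: "\<And>x. Sstar x = minimizers Z (\<lambda>z. g z x)"
  \<comment> \<open>data and regression estimate\<close>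
    and "prob_space M"
    and xs: "\<And>i. i \<ge> 1 \<Longrightarrow> xs i \<in> borel_measurable M"
    and ys: "\<And>i. i \<ge> 1 \<Longrightarrow> ys i \<in> borel_measurable M"
    and joint_obs: "\<And>i. i \<ge> 1 \<Longrightarrow>
      distr M (borel \<Otimes>\<^sub>M borel) (\<lambda>\<omega>. (ys i \<omega>, xs i \<omega>))
        = distr N (borel \<Otimes>\<^sub>M borel) (\<lambda>\<nu>. (Y \<nu>, X \<nu>))"
    and epss: "\<And>i \<omega>. epss i \<omega> = ys i \<omega> - fstar (xs i \<omega>)"
    and reg: "\<And>n. n \<ge> 1 \<Longrightarrow> (\<lambda>(D, x). reg n D x)
      \<in> borel_measurable ((\<Pi>\<^sub>M i\<in>{1..n}. (borel \<Otimes>\<^sub>M borel)) \<Otimes>\<^sub>M borel)"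
    and fhat: "\<And>n \<omega> x. fhat n \<omega> x = reg n (data_set ys xs n \<omega>) x"
  \<comment> \<open>constants of the concentration inequality, radius, and the DRO problem\<close>
    and C: "C \<ge> 1" and c0: "c0 > 0"
    and concentration: "\<And>k n x. k > 0 \<Longrightarrow> n \<ge> 1 \<Longrightarrow> x \<in> XX \<Longrightarrow>
      {\<omega> \<in> space M. wasserstein p
          (full_info_empirical fstar n (\<lambda>i. ys i \<omega>) (\<lambda>i. xs i \<omega>) x) (cond_law fstar Pe x)
        \<ge> ennreal k} \<in> sets M \<and>
      measure M {\<omega> \<in> space M. wasserstein p
          (full_info_empirical fstar n (\<lambda>i. ys i \<omega>) (\<lambda>i. xs i \<omega>) x) (cond_law fstar Pe x)
        \<ge> ennreal k} \<le> concentration_bound C c0 a p DIM('y) n k"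
    and zeta: "\<And>n \<alpha> x.
      zeta n \<alpha> x = 2 * kappa n (\<alpha> / 4) x + kappa2 C c0 a p DIM('y) n \<alpha>"
    and Amb: "\<And>n x \<omega>. Amb n x \<omega> = wasserstein_ball p YY
      (residual_empirical YY (fhat n \<omega>) n (\<lambda>i. ys i \<omega>) (\<lambda>i. xs i \<omega>) x) (zeta n (alpha n) x)"
    and dro_objective: "AE x in PX. \<forall>n\<ge>1. \<forall>\<omega>\<in>space M.
      (\<forall>z\<in>Z. bdd_above ((\<lambda>Q. \<integral>y. c z y \<partial>Q) ` Amb n x \<omega>)) \<and>
      lsc_on Z (worst_case c (Amb n x \<omega>))"
    and vhat: "\<And>n x \<omega>. vhat n x \<omega> = min_value Z (worst_case c (Amb n x \<omega>))"
    and vhat_measurable: "AE x in PX. \<forall>n\<ge>1. vhat n x \<in> borel_measurable M"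
    and zhat: "AE x in PX. \<forall>n\<ge>1. zhat n x \<in> borel_measurable M \<and>
      (\<forall>\<omega>\<in>space M. zhat n x \<omega> \<in> minimizers Z (worst_case c (Amb n x \<omega>)))"
  \<comment> \<open>hypotheses of the theorem\<close>
    and p: "p \<ge> 1" "p \<noteq> real DIM('y) / 2"
    and light_tail: "a > p" "integrable N (\<lambda>\<nu>. exp (norm (eps \<nu>) powr a))"
    and regression: "AE x in PX. \<forall>n\<ge>1. \<forall>\<alpha>. 0 < \<alpha> \<longrightarrow> \<alpha> < 1 \<longrightarrow>
      kappa n \<alpha> x > 0 \<and>
      measure M {\<omega> \<in> space M. norm (fstar x - fhat n \<omega> x) powr p > kappa n \<alpha> x powr p} \<le> \<alpha> \<and>
      measure M {\<omega> \<in> space M.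
        (1 / real n) * (\<Sum>i=1..n. norm (fstar (xs i \<omega>) - fhat n \<omega> (xs i \<omega>)) powr p)
          > kappa n \<alpha> x powr p} \<le> \<alpha>"
    and c_lsc: "\<And>y. y \<in> YY \<Longrightarrow> lsc_on Z (\<lambda>z. c z y)"
    and c_cont: "\<And>z. z \<in> Z \<Longrightarrow> continuous_on YY (c z)"
    and growth: "B \<ge> 0"
      "\<And>z y. z \<in> Z \<Longrightarrow> y \<in> YY \<Longrightarrow> \<bar>c z y\<bar> \<le> B * (1 + norm y powr p)"
    and alpha: "\<And>n. n \<ge> 1 \<Longrightarrow> 0 < alpha n \<and> alpha n < 1" "summable alpha"
    and radius_limit: "AE x in PX. (\<lambda>n. zeta n (alpha n) x) \<longlonglongrightarrow> 0"
    and iid: "prob_space.indep_vars M (\<lambda>_. borel) epss {1..}"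
      "\<And>i. i \<ge> 1 \<Longrightarrow> distr M borel (epss i) = Pe"
  shows "AE x in PX.
    tendsto_in_prob M (\<lambda>n. vhat n x) (vstar x) \<and>
    tendsto_in_prob M (\<lambda>n \<omega>. infdist (zhat n x \<omega>) (Sstar x)) 0 \<and>
    tendsto_in_prob M (\<lambda>n \<omega>. g (zhat n x \<omega>) x) (vstar x)"
proof -
  interpret N: prob_space N by fact
  interpret M: prob_space M by fact
  have [measurable]: "fstar \<in> borel_measurable borel" by (rule fstar)
  have YYc: "closed YY" unfolding YY(1) by (rule closed_support_of)
  have YYb: "{y. y \<in> YY} \<in> sets borel" using YYc by simp
  have p0: "p > 0" and a0: "a > 0" using p(1) light_tail(1) by auto
  have Ym: "Y \<in> borel_measurable N"
    using X eps by (subst measurable_cong[OF Y]) auto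
  have sPe: "sets Pe = sets borel" and sPX: "sets PX = sets borel" by (simp_all add: Pe PX)
  have pPe: "prob_space Pe" unfolding Pe by (rule N.prob_space_distr[OF eps])
  interpret Pe: prob_space Pe by (rule pPe)
  \<comment> \<open>\<open>Y\<close> lies in its support almost surely; independence converts this
    into a statement about the error law shifted by \<open>fstar x\<close>, for almost every fixed
    \<open>x\<close>.\<close>
  have "AE \<nu> in N. Y \<nu> \<in> YY"
    unfolding YY(1) by (rule AE_distrD[OF Ym AE_support_of]) simp
  then have "AE \<nu> in N. fstar (X \<nu>) + eps \<nu> \<in> YY"
    using AE_space by eventually_elim (simp add: Y)
  moreover have "{w \<in> space (borel \<Otimes>\<^sub>M borel). fstar (fst w) + snd w \<in> YY} \<in> sets (borel \<Otimes>\<^sub>M borel)"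
  proof -
    have "YY \<in> sets borel" using YYc by simp
    then show ?thesis by measurable
  qed
  ultimately have AE_YY: "AE x in PX. AE e in Pe. fstar x + e \<in> YY"
    unfolding PX Pe
    using N.AE_AE_of_indep_set[OF X eps indep_X_eps, where R="\<lambda>x e. fstar x + e \<in> YY"] by blast
  have moment: "integrable Pe (\<lambda>e. norm e powr p)"
    unfolding Pe
  proof (subst integrable_distr_eq[OF eps])
    show "integrable N (\<lambda>\<nu>. norm (eps \<nu>) powr p)"
      using eps powr_le_exp_powr[OF p0 light_tail(1)]
      by (intro Bochner_Integration.integrable_bound[OF light_tail(2)]) auto
  qed simp
  have epssm: "epss i \<in> borel_measurable M" if "i \<ge> 1" for i
    unfolding epss[abs_def]
    using measurable_compose[OF xs[OF that] fstar] ys[OF that] by simp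
  \<comment> \<open>The evaluation point \<open>V\<close> is random because the estimate is also
    evaluated at the sample points \<open>xs i\<close>, on which it depends itself.\<close>
  have fhatm: "(\<lambda>\<omega>. fhat n \<omega> (V \<omega>)) \<in> borel_measurable M"
    if n: "n \<ge> 1" and V: "V \<in> borel_measurable M" for n V
  proof -
    have "data_set ys xs n \<in> measurable M (\<Pi>\<^sub>M i\<in>{1..n}. (borel \<Otimes>\<^sub>M borel))"
      unfolding data_set_def[abs_def]
      by (intro measurable_restrict measurable_Pair) (auto intro: xs ys)
    then have "(\<lambda>\<omega>. (data_set ys xs n \<omega>, V \<omega>))
        \<in> measurable M ((\<Pi>\<^sub>M i\<in>{1..n}. (borel \<Otimes>\<^sub>M borel)) \<Otimes>\<^sub>M borel)"
      using V by (rule measurable_Pair)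
    from measurable_compose[OF this reg[OF n]] show ?thesis by (simp add: fhat)
  qed
  have "AE x in PX. x \<in> XX"
    unfolding XX by (rule AE_support_of[OF sPX])
  then show ?thesis
    using AE_YY g_lsc dro_objective vhat_measurable zhat regression radius_limit
  proof eventually_elim
    case (elim x)
    note xXX = elim(1) and supp = elim(2) and glsc = elim(3) and dro = elim(4)
      and vhm = elim(5) and zh = elim(6) and regr = elim(7) and rad = elim(8)
    define P where "P = cond_law fstar Pe x"
    have shm: "(\<lambda>e. fstar x + e) \<in> measurable Pe borel"
      unfolding measurable_cong_sets[OF sPe refl] by simp
    have PP: "prob_space P" "sets P = sets borel"
      unfolding P_def cond_law_def by (simp_all add: Pe.prob_space_distr[OF shm])
    have P_YY: "AE y in P. y \<in> YY"
      unfolding P_def cond_law_def by (subst AE_distr_iff[OF shm]) (use YYb supp in auto)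
    have P_on: "P \<in> prob_measures_on YY"
      unfolding prob_measures_on_def
      using PP P_YY prob_space.AE_in_set_eq_1[OF PP(1), of YY] YYc
      by (simp add: finite_measure.emeasure_eq_measure[OF prob_space.finite_measure[OF PP(1)]])
    have P_moment: "integrable P (\<lambda>y. norm y powr p)"
      unfolding P_def cond_law_def
      using integrable_norm_powr_add[OF p(1) pPe sPe moment]
      by (subst integrable_distr_eq[OF shm]) auto
    have P_int: "(\<integral>y. c z y \<partial>P) = g z x" if "z \<in> Z" for z
      unfolding P_def cond_law_def g true_objective_def
      by (rule integral_distr[OF shm c_measurable[OF that]])
    obtain z0 where z0: "z0 \<in> minimizers Z (\<lambda>z. g z x)" "vstar x = g z0 x"
      using min_value_attained[OF Z glsc] unfolding vstar by blast
    have z0Z: "z0 \<in> Z" and vstar_le: "\<And>z. z \<in> Z \<Longrightarrow> vstar x \<le> g z x"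
      using minimizersD[OF z0(1)] unfolding z0(2) by auto
    define k where "k n = kappa n (alpha n / 4) x" for n
    define k2 where "k2 n = kappa2 C c0 a p DIM('y) n (alpha n)" for n
    define \<zeta> where "\<zeta> n = zeta n (alpha n) x" for n
    have \<zeta>_eq: "\<zeta> n = 2 * k n + k2 n" for n by (simp add: \<zeta>_def zeta k_def k2_def)
    have al: "0 < alpha n / 4" "alpha n / 4 < 1" "0 < alpha n" "alpha n < 1" if "n \<ge> 1" for n
      using alpha(1)[OF that] by auto
    have kpos: "k n > 0" if "n \<ge> 1" for n
      using regr al[OF that] that unfolding k_def by blast
    have k2: "k2 n > 0" "concentration_bound C c0 a p DIM('y) n (k2 n) = alpha n / 2" if "n \<ge> 1" for n
      unfolding k2_def
      using kappa2_pos_and_concentration_bound[OF C c0 al(3,4)[OF that] that p0 a0, of "DIM('y)"]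
      by (simp_all add: Suc_le_eq)
    define E1 where "E1 n = {\<omega> \<in> space M. norm (fstar x - fhat n \<omega> x) powr p > k n powr p}" for n
    define E2 where "E2 n = {\<omega> \<in> space M.
      (1 / real n) * (\<Sum>i=1..n. norm (fstar (xs i \<omega>) - fhat n \<omega> (xs i \<omega>)) powr p) > k n powr p}" for n
    define E3 where "E3 n = {\<omega> \<in> space M. wasserstein p
      (full_info_empirical fstar n (\<lambda>i. ys i \<omega>) (\<lambda>i. xs i \<omega>) x) P \<ge> ennreal (k2 n)}" for n
    \<comment> \<open>Outside \<open>E4\<close> every full-information sample point lies in
      \<open>YY\<close>, hence is fixed by the projection. The union over all \<open>i\<close> is a
      single null set for all \<open>n\<close>.\<close>
    define E4 where "E4 = (\<Union>i\<in>{1..}. {\<omega> \<in> space M. fstar x + epss i \<omega> \<notin> YY})"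
    define bad where "bad n = E1 n \<union> E2 n \<union> E3 n \<union> E4" for n
    have E1: "E1 n \<in> sets M" "measure M (E1 n) \<le> alpha n / 4" if n: "n \<ge> 1" for n
    proof -
      have [measurable]: "(\<lambda>\<omega>. fhat n \<omega> x) \<in> borel_measurable M" by (rule fhatm[OF n]) simp
      show "E1 n \<in> sets M" unfolding E1_def by measurable
      show "measure M (E1 n) \<le> alpha n / 4"
        unfolding E1_def k_def using regr n al[OF n] by blast
    qed
    have E2: "E2 n \<in> sets M" "measure M (E2 n) \<le> alpha n / 4" if n: "n \<ge> 1" for n
    proof -
      have "(\<lambda>\<omega>. norm (fstar (xs i \<omega>) - fhat n \<omega> (xs i \<omega>)) powr p) \<in> borel_measurable M"
        if "i \<in> {1..n}" for i
      proof -
        have i: "i \<ge> 1" using that by simp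
        have [measurable]: "(\<lambda>\<omega>. fhat n \<omega> (xs i \<omega>)) \<in> borel_measurable M" "xs i \<in> borel_measurable M"
          by (rule fhatm[OF n xs[OF i]], rule xs[OF i])
        show ?thesis by measurable
      qed
      then have [measurable]: "(\<lambda>\<omega>. \<Sum>i=1..n. norm (fstar (xs i \<omega>) - fhat n \<omega> (xs i \<omega>)) powr p)
          \<in> borel_measurable M"
        by (rule borel_measurable_sum)
      show "E2 n \<in> sets M" unfolding E2_def by measurable
      show "measure M (E2 n) \<le> alpha n / 4"
        unfolding E2_def k_def using regr n al[OF n] by blast
    qed
    have E3: "E3 n \<in> sets M" "measure M (E3 n) \<le> alpha n / 2" if n: "n \<ge> 1" for n
      using concentration[OF k2(1)[OF n] n xXX] unfolding k2(2)[OF n] E3_def P_def by auto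
    have E4: "E4 \<in> null_sets M"
      unfolding E4_def
    proof (rule null_sets_UN')
      fix i :: nat assume "i \<in> {1..}"
      then have i: "i \<ge> 1" by simp
      have [measurable]: "epss i \<in> borel_measurable M" by (rule epssm[OF i])
      have [measurable]: "YY \<in> sets borel" using YYc by simp
      have "AE \<omega> in M. fstar x + epss i \<omega> \<in> YY"
        using supp unfolding iid(2)[OF i, symmetric] by (rule AE_distrD[OF epssm[OF i]])
      then show "{\<omega> \<in> space M. fstar x + epss i \<omega> \<notin> YY} \<in> null_sets M"
        by (subst (asm) AE_iff_null) measurable
    qed simp
    \<comment> \<open>The risk \<open>alpha n\<close> is spent as one quarter on each regression
      bound and one half on concentration, which matches the level \<open>alpha n / 4\<close> at
      which \<open>kappa\<close> enters the radius.\<close>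
    have bad: "bad n \<in> sets M" "measure M (bad n) \<le> alpha n" if n: "n \<ge> 1" for n
    proof -
      note m = E1(1)[OF n] E2(1)[OF n] E3(1)[OF n] null_setsD2[OF E4]
      show "bad n \<in> sets M" unfolding bad_def using m by auto
      have "measure M (bad n) \<le> measure M (E1 n) + measure M (E2 n) + measure M (E3 n) + measure M E4"
        unfolding bad_def using m
        by (intro order_trans[OF measure_Un_le] add_right_mono) auto
      then show "measure M (bad n) \<le> alpha n"
        using E1(2)[OF n] E2(2)[OF n] E3(2)[OF n] E4 by (simp add: measure_eq_0_null_sets)
    qed
    have bad_lim: "(\<lambda>n. measure M (bad n)) \<longlonglongrightarrow> 0"
      by (rule tendsto_sandwich[OF _ _ tendsto_const summable_LIMSEQ_zero[OF alpha(2)]])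
        (auto intro!: eventually_sequentiallyI[of 1] bad(2))
    have vhat_eq: "vhat n x \<omega> = worst_case c (Amb n x \<omega>) (zhat n x \<omega>)"
      and zhatZ: "zhat n x \<omega> \<in> Z"
      and vhat_le: "\<And>z. z \<in> Z \<Longrightarrow> vhat n x \<omega> \<le> worst_case c (Amb n x \<omega>) z"
      if "n \<ge> 1" "\<omega> \<in> space M" for n \<omega>
    proof -
      have z: "zhat n x \<omega> \<in> minimizers Z (worst_case c (Amb n x \<omega>))" using zh that by blast
      show *: "vhat n x \<omega> = worst_case c (Amb n x \<omega>) (zhat n x \<omega>)"
        unfolding vhat by (rule min_value_minimizer[OF z])
      show "zhat n x \<omega> \<in> Z" by (rule minimizersD(1)[OF z])
      show "vhat n x \<omega> \<le> worst_case c (Amb n x \<omega>) w" if "w \<in> Z" for w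
        unfolding * by (rule minimizersD(2)[OF z that])
    qed
    have coupling: "\<exists>\<pi>\<in>couplings P (residual_empirical YY (fhat n \<omega>) n (\<lambda>i. ys i \<omega>) (\<lambda>i. xs i \<omega>) x).
        coupling_cost p \<pi> \<le> ennreal (\<zeta> n powr p)"
      if n: "n \<ge> 1" and \<omega>: "\<omega> \<in> space M - bad n" for n \<omega>
      unfolding \<zeta>_eq
    proof (rule law_residual_coupling[OF p(1) n YYc YY(3) kpos[OF n] k2(1)[OF n]])
      show "norm (fstar x - fhat n \<omega> x) powr p \<le> k n powr p"
        using \<omega> by (auto simp: bad_def E1_def)
      show "(1 / real n) * (\<Sum>i=1..n. norm (fstar (xs i \<omega>) - fhat n \<omega> (xs i \<omega>)) powr p) \<le> k n powr p"
        using \<omega> unfolding bad_def E2_def not_less[symmetric] by blast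
      show "fstar x + (ys i \<omega> - fstar (xs i \<omega>)) \<in> YY" if "i \<in> {1..n}" for i
        using \<omega> that by (auto simp: bad_def E4_def epss)
      show "wasserstein p (full_info_empirical fstar n (\<lambda>i. ys i \<omega>) (\<lambda>i. xs i \<omega>) x) P < ennreal (k2 n)"
        using \<omega> unfolding bad_def E3_def not_le[symmetric] by blast
    qed
    have P_Amb: "P \<in> Amb n x \<omega>" if n: "n \<ge> 1" and \<omega>: "\<omega> \<in> space M - bad n" for n \<omega>
    proof -
      obtain \<pi> where \<pi>: "\<pi> \<in> couplings P (residual_empirical YY (fhat n \<omega>) n (\<lambda>i. ys i \<omega>) (\<lambda>i. xs i \<omega>) x)"
        "coupling_cost p \<pi> \<le> ennreal (\<zeta> n powr p)"
        using coupling[OF n \<omega>] by blast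
      have "\<zeta> n \<ge> 0" using kpos[OF n] k2(1)[OF n] by (simp add: \<zeta>_eq)
      from wasserstein_leI[OF p(1) this \<pi>] show ?thesis
        using P_on unfolding Amb wasserstein_ball_def \<zeta>_def by blast
    qed
    have lower: "vstar x \<le> g (zhat n x \<omega>) x" "g (zhat n x \<omega>) x \<le> vhat n x \<omega>"
      if n: "n \<ge> 1" and \<omega>: "\<omega> \<in> space M - bad n" for n \<omega>
    proof -
      have \<omega>': "\<omega> \<in> space M" using \<omega> by blast
      note zZ = zhatZ[OF n \<omega>']
      show "vstar x \<le> g (zhat n x \<omega>) x" by (rule vstar_le[OF zZ])
      \<comment> \<open>A real supremum is only known to dominate its members when the family is
        bounded above; real-valuedness of the robust objective provides this.\<close>
      have "bdd_above ((\<lambda>Q. \<integral>y. c (zhat n x \<omega>) y \<partial>Q) ` Amb n x \<omega>)"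
        by (rule bspec[OF conjunct1[OF bspec[OF mp[OF spec[OF dro] n] \<omega>']] zZ])
      from cSUP_upper[OF P_Amb[OF n \<omega>] this]
      show "g (zhat n x \<omega>) x \<le> vhat n x \<omega>"
        unfolding vhat_eq[OF n \<omega>'] worst_case_def P_int[OF zZ] .
    qed
    have upper: "\<forall>\<^sub>F n in sequentially. n \<ge> 1 \<and> (\<forall>\<omega>\<in>space M - bad n. vhat n x \<omega> \<le> vstar x + \<delta>)"
      if \<delta>: "\<delta> > 0" for \<delta>
    proof -
      \<comment> \<open>\<open>r\<close> depends only on \<open>x\<close>, \<open>z0\<close> and
        \<open>\<delta>\<close>, and \<open>\<zeta> n\<close> is deterministic, so one threshold in
        \<open>n\<close> works for all \<open>\<omega>\<close> outside \<open>bad n\<close>.\<close>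
      obtain r where r: "r > 0" "\<And>Q \<pi>. \<pi> \<in> couplings Q P \<Longrightarrow> AE y in Q. y \<in> YY \<Longrightarrow>
          coupling_cost p \<pi> \<le> ennreal (r powr p) \<Longrightarrow> (\<integral>y. c z0 y \<partial>Q) \<le> (\<integral>y. c z0 y \<partial>P) + \<delta>"
        using expectation_le_of_coupling_cost_le[OF p(1) PP YYc P_YY P_moment
          c_measurable[OF z0Z] c_cont[OF z0Z] growth(1) growth(2)[OF z0Z] \<delta>] by blast
      have "\<forall>\<^sub>F n in sequentially. \<zeta> n < r / 3"
        using rad r(1) unfolding \<zeta>_def by (intro order_tendstoD) auto
      then show ?thesis using eventually_ge_at_top[of 1]
      proof eventually_elim
        case (elim n)
        note n = elim(2)
        have \<zeta>0: "\<zeta> n > 0" using kpos[OF n] k2(1)[OF n] by (simp add: \<zeta>_eq)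
        have "vhat n x \<omega> \<le> vstar x + \<delta>" if \<omega>: "\<omega> \<in> space M - bad n" for \<omega>
        proof -
          have "(\<integral>y. c z0 y \<partial>Q) \<le> vstar x + \<delta>" if Q: "Q \<in> Amb n x \<omega>" for Q
          proof -
            obtain \<pi> where \<pi>: "\<pi> \<in> couplings P (residual_empirical YY (fhat n \<omega>) n (\<lambda>i. ys i \<omega>) (\<lambda>i. xs i \<omega>) x)"
              "coupling_cost p \<pi> \<le> ennreal (\<zeta> n powr p)"
              using coupling[OF n \<omega>] by blast
            obtain \<rho> where \<rho>: "\<rho> \<in> couplings Q P" "coupling_cost p \<rho> \<le> ennreal ((3 * \<zeta> n) powr p)"
              using wasserstein_ball_coupling[OF p(1) \<zeta>0 Q[unfolded Amb residual_empirical_def, folded \<zeta>_def]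
                \<pi>[unfolded residual_empirical_def]] by blast
            note \<rho>(2)
            also have "ennreal ((3 * \<zeta> n) powr p) \<le> ennreal (r powr p)"
              using elim(1) \<zeta>0 p0 by (intro ennreal_leI powr_mono2) auto
            finally have cost: "coupling_cost p \<rho> \<le> ennreal (r powr p)" .
            have Q': "prob_space Q" "sets Q = sets borel" "emeasure Q YY = 1"
              using Q by (auto simp: Amb wasserstein_ball_def prob_measures_on_def)
            then have "AE y in Q. y \<in> YY"
              using prob_space.AE_in_set_eq_1[OF Q'(1), of YY] YYc by (simp add: measure_def)
            from r(2)[OF \<rho>(1) this cost] show ?thesis
              unfolding P_int[OF z0Z] z0(2) .
          qed
          \<comment> \<open>\<open>P_Amb\<close> is used here for nonemptiness of the ambiguity set,
            without which its real supremum would not be controlled by a bound on the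
            members.\<close>
          then have "worst_case c (Amb n x \<omega>) z0 \<le> vstar x + \<delta>"
            unfolding worst_case_def using P_Amb[OF n \<omega>] by (intro cSUP_least) auto
          moreover have "vhat n x \<omega> \<le> worst_case c (Amb n x \<omega>) z0"
            using \<omega> by (intro vhat_le n z0Z) auto
          ultimately show ?thesis by simp
        qed
        then show ?case using n by blast
      qed
    qed
    have near: "\<forall>\<^sub>F n in sequentially. \<forall>\<omega>\<in>space M - bad n. zhat n x \<omega> \<in> Z \<and>
        \<bar>vhat n x \<omega> - vstar x\<bar> \<le> \<delta> \<and> \<bar>g (zhat n x \<omega>) x - vstar x\<bar> \<le> \<delta>"
      if \<delta>: "\<delta> > 0" for \<delta>
      using upper[OF \<delta>]
    proof eventually_elim
      case (elim n)
      show ?case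
      proof
        fix \<omega> assume \<omega>: "\<omega> \<in> space M - bad n"
        have n: "n \<ge> 1" and "vhat n x \<omega> \<le> vstar x + \<delta>" using elim \<omega> by blast+
        moreover have "zhat n x \<omega> \<in> Z" using \<omega> by (intro zhatZ n) blast
        ultimately show "zhat n x \<omega> \<in> Z \<and>
            \<bar>vhat n x \<omega> - vstar x\<bar> \<le> \<delta> \<and> \<bar>g (zhat n x \<omega>) x - vstar x\<bar> \<le> \<delta>"
          using lower[OF n \<omega>] by (simp add: abs_le_iff)
      qed
    qed
    have zhm: "zhat n x \<in> borel_measurable M" if "n \<ge> 1" for n using zh that by blast
    show ?case
    proof (intro conjI)
      show "tendsto_in_prob M (\<lambda>n. vhat n x) (vstar x)"
      proof (rule M.tendsto_in_probI[of _ bad])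
        show "\<forall>\<^sub>F n in sequentially. \<forall>\<omega>\<in>space M - bad n. \<bar>vhat n x \<omega> - vstar x\<bar> \<le> \<delta>"
          if "\<delta> > 0" for \<delta>
          using near[OF that] by eventually_elim blast
      qed (use vhm bad bad_lim in auto)
      show "tendsto_in_prob M (\<lambda>n \<omega>. infdist (zhat n x \<omega>) (Sstar x)) 0"
      proof (rule M.tendsto_in_probI[of _ bad])
        fix \<eta> :: real assume "\<eta> > 0"
        \<comment> \<open>The true objective at \<open>zhat\<close>, rather than the robust one,
          measures the near-optimality that controls the distance to \<open>Sstar x\<close>.\<close>
        from near_minimizers[OF Z glsc this] obtain \<delta> where \<delta>: "\<delta> > 0"
          "\<And>z. z \<in> Z \<Longrightarrow> g z x \<le> vstar x + \<delta> \<Longrightarrow> infdist z (Sstar x) \<le> \<eta>"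
          unfolding vstar Sstar by blast
        from near[OF \<delta>(1)]
        show "\<forall>\<^sub>F n in sequentially. \<forall>\<omega>\<in>space M - bad n. \<bar>infdist (zhat n x \<omega>) (Sstar x) - 0\<bar> \<le> \<eta>"
        proof eventually_elim
          case (elim n)
          show ?case
          proof
            fix \<omega> assume "\<omega> \<in> space M - bad n"
            with elim have "zhat n x \<omega> \<in> Z" "\<bar>g (zhat n x \<omega>) x - vstar x\<bar> \<le> \<delta>" by blast+
            then show "\<bar>infdist (zhat n x \<omega>) (Sstar x) - 0\<bar> \<le> \<eta>"
              using \<delta>(2)[of "zhat n x \<omega>"] by (simp add: infdist_nonneg abs_le_iff)
          qed
        qed
      next
        show "(\<lambda>\<omega>. infdist (zhat n x \<omega>) (Sstar x)) \<in> borel_measurable M" if "n \<ge> 1" for n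
          by (rule borel_measurable_continuous_on[OF _ zhm[OF that]]) (intro continuous_intros)
      qed (use bad bad_lim in auto)
      show "tendsto_in_prob M (\<lambda>n \<omega>. g (zhat n x \<omega>) x) (vstar x)"
      proof (rule M.tendsto_in_probI[of _ bad])
        show "\<forall>\<^sub>F n in sequentially. \<forall>\<omega>\<in>space M - bad n. \<bar>g (zhat n x \<omega>) x - vstar x\<bar> \<le> \<delta>"
          if "\<delta> > 0" for \<delta>
          using near[OF that] by eventually_elim blast
        show "(\<lambda>\<omega>. g (zhat n x \<omega>) x) \<in> borel_measurable M" if "n \<ge> 1" for n
          using compact_imp_closed[OF Z(1)] glsc zhm[OF that] zhatZ[OF that]
          by (rule borel_measurable_lsc_on)
      qed (use bad bad_lim in auto)
    qed
  qed
qed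

end
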